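(* Under the transformation $$w(y,t)=C(t)V(y,t)\eta(y,t),\quad y_0(t)\le y\le y_1(t),\ t>0,$$ with $$C(t)=1-\int_0^t w_y(y_1(\tau),\tau)\,d\tau,\qquad \eta(y,t)=\exp\Big(\frac1D\int_y^{y_1(t)}V(\xi,t)\,d\xi\Big),$$ the free boundary problem $$V_t=DV_{yy}-2VV_y,\quad y_0(t)<y<y_1(t),\ t>0,$$ $$V(y_0(t),t)=f(t)-\beta,\qquad V(y_1(t),t)=0,\qquad D\frac{V_y(y_1(t),t)}{\beta}=\frac{\beta(1-\beta)-\beta\dot y_1(t)}{\beta+1},\quad t>0,$$ $$V(y,0)=V_0(y),\ C_1\le y\le C_2,\qquad y_0(0)=C_1,\ y_1(0)=C_2,$$ $$y_0(t)=C_1-2\beta t+\int_0^t\Big(f(\tau)-D\frac{V_y(y_0(\tau),\tau)}{f(\tau)}\Big)d\tau,\qquad y_1(t)=C_2+(1-\beta)t-\frac{D(\beta+1)}{\beta^2}\int_0^tV_y(y_1(\tau),\tau)d\tau$$ is equivalent to the free boundary problem $$w_t=Dw_{yy},\quad y_0(t)<y<y_1(t),\ t>0,$$ $$w(y_0(t),t)=(f(t)-\beta)\Big(C(t)+\frac1D\int_{y_0(t)}^{y_1(t)}w(\xi,t)\,d\xi\Big),\qquad w(y_1(t),t)=0,\quad t>0,$$ $$\frac{Dw_y(y_1(t),t)}{\beta C(t)}=\frac{\beta(1-\beta)-\beta\dot y_1(t)}{\beta+1},\quad t>0,$$ $$w(y,0)=F(y),\ C_1\le y\le C_2,\qquad y_0(0)=C_1,\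 y_1(0)=C_2,$$ where $$F(y)=V_0(y)\exp\Big(\frac1D\int_y^{C_2}V_0(\xi)d\xi\Big)=V_0(y)\Big(1+\frac1D\int_y^{C_2}w(\xi,0)d\xi\Big)$$ and the free boundaries are given by $$y_0(t)=C_1-\beta^2\int_0^t\frac{d\tau}{f(\tau)}-D\int_0^t\frac{w_y(y_0(\tau),\tau)}{w(y_0(\tau),\tau)}\Big(1-\frac{\beta}{f(\tau)}\Big)d\tau,$$ $$y_1(t)=C_2+(1-\beta)t+\frac{D(\beta+1)}{\beta^2}\log\Big(1-\int_0^tw_y(y_1(\tau),\tau)d\tau\Big).$$
   Context: $D>0$, $\beta>0$, $b>0$, $\sigma>0$ are constants. The data satisfy: $f\in C^1[0,\sigma]$, $u_0\in C^1[0,b]$, $u_0(0)=f(0)$, $u_0(b)=\beta$, $u_0(x)>\beta$ for $0\le x<b$, and $f(t)>\frac{3\beta}{2}$. $C_1$ is an arbitrary constant, $U_0=\int_0^b\frac{d\eta}{u_0(\eta)}$, $C_2=C_1+U_0$, $g(x)=C_1+\int_0^x\frac{d\eta}{u_0(\eta)}$, $v_0(y)=u_0(g^{-1}(y))$ and $V_0(y)=v_0(y)-\beta$ for $C_1\le y\le C_2$. Solutions are understood in the classical sense; conditions "for $t>0$" are understood on the time interval where $f$ is given. A dot denotes differentiation in $t$. *)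

theory Defs
  imports "HOL-Analysis.Analysis"
begin

text \<open>Continuous differentiability on an interval; derivatives are one-sided at an endpoint
  that belongs to the interval.\<close>

definition cont_diff_on :: "real set \<Rightarrow> (real \<Rightarrow> real) \<Rightarrow> bool" where
  "cont_diff_on S h \<longleftrightarrow>
     (\<exists>h'. continuous_on S h' \<and> (\<forall>x\<in>S. (h has_real_derivative h' x) (at x within S)))"

definition U0 :: "(real \<Rightarrow> real) \<Rightarrow> real \<Rightarrow> real" where
  "U0 u0 b = integral {0..b} (\<lambda>\<xi>. 1 / u0 \<xi>)"

definition C2 :: "(real \<Rightarrow> real) \<Rightarrow> real \<Rightarrow> real \<Rightarrow> real" where
  "C2 u0 b C1 = C1 + U0 u0 b"

definition g :: "(real \<Rightarrow> real) \<Rightarrow> real \<Rightarrow> real \<Rightarrow> real" where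
  "g u0 C1 x = C1 + integral {0..x} (\<lambda>\<xi>. 1 / u0 \<xi>)"

definition v0 :: "(real \<Rightarrow> real) \<Rightarrow> real \<Rightarrow> real \<Rightarrow> real \<Rightarrow> real" where
  "v0 u0 b C1 y = u0 (inv_into {0..b} (g u0 C1) y)"

definition V0 :: "real \<Rightarrow> (real \<Rightarrow> real) \<Rightarrow> real \<Rightarrow> real \<Rightarrow> real \<Rightarrow> real" where
  "V0 \<beta> u0 b C1 y = v0 u0 b C1 y - \<beta>"

definition F :: "real \<Rightarrow> real \<Rightarrow> (real \<Rightarrow> real) \<Rightarrow> real \<Rightarrow> real \<Rightarrow> real \<Rightarrow> real" where
  "F D \<beta> u0 b C1 y =
     V0 \<beta> u0 b C1 y * exp (1 / D * integral {y..C2 u0 b C1} (V0 \<beta> u0 b C1))"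

text \<open>A function of \<open>(y, t)\<close> is relevant only on the moving domain \<open>y0 t \<le> y \<le> y1 t\<close>,
  \<open>0 \<le> t \<le> \<sigma>\<close>. Partial derivatives are therefore taken within that domain: the space
  derivatives are one-sided on the free boundaries, the time derivative at the final time.
  At a point with \<open>0 < t\<close> and \<open>y0 t < y < y1 t\<close> the time derivative only depends on the
  values on the domain, since the free boundaries are continuous.\<close>

definition part_y ::
  "(real \<Rightarrow> real) \<Rightarrow> (real \<Rightarrow> real) \<Rightarrow> (real \<Rightarrow> real \<Rightarrow> real) \<Rightarrow> real \<Rightarrow> real \<Rightarrow> real" where
  "part_y y0 y1 z y t = vector_derivative (\<lambda>\<xi>. z \<xi> t) (at y within {y0 t..y1 t})"

definition part_yy ::
  "(real \<Rightarrow> real) \<Rightarrow> (real \<Rightarrow> real) \<Rightarrow> (real \<Rightarrow> real \<Rightarrow> real) \<Rightarrow> real \<Rightarrow> real \<Rightarrow> real" where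
  "part_yy y0 y1 z = part_y y0 y1 (part_y y0 y1 z)"

definition part_t :: "real \<Rightarrow> (real \<Rightarrow> real \<Rightarrow> real) \<Rightarrow> real \<Rightarrow> real \<Rightarrow> real" where
  "part_t \<sigma> z y t = vector_derivative (\<lambda>\<tau>. z y \<tau>) (at t within {0..\<sigma>})"

definition time_deriv :: "real \<Rightarrow> (real \<Rightarrow> real) \<Rightarrow> real \<Rightarrow> real" where
  "time_deriv \<sigma> s t = vector_derivative s (at t within {0..\<sigma>})"

definition closed_dom ::
  "real set \<Rightarrow> (real \<Rightarrow> real) \<Rightarrow> (real \<Rightarrow> real) \<Rightarrow> (real \<times> real) set" where
  "closed_dom I y0 y1 = {(y, t). t \<in> I \<and> y0 t \<le> y \<and> y \<le> y1 t}"

definition open_dom ::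
  "real set \<Rightarrow> (real \<Rightarrow> real) \<Rightarrow> (real \<Rightarrow> real) \<Rightarrow> (real \<times> real) set" where
  "open_dom I y0 y1 = {(y, t). t \<in> I \<and> y0 t < y \<and> y < y1 t}"

text \<open>Regularity of a classical solution: the free boundaries are continuous up to \<open>t = 0\<close>,
  \<open>C\<^sup>1\<close> for \<open>t > 0\<close> and do not meet; the unknown is continuous up to \<open>t = 0\<close>, has a space
  derivative that is continuous up to the free boundaries for \<open>t > 0\<close>, and is \<open>C\<^sup>2\<close> in space
  and \<open>C\<^sup>1\<close> in time inside the domain.\<close>

definition classical ::
  "real \<Rightarrow> (real \<Rightarrow> real) \<Rightarrow> (real \<Rightarrow> real) \<Rightarrow> (real \<Rightarrow> real \<Rightarrow> real) \<Rightarrow> bool" where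
  "classical \<sigma> y0 y1 z \<longleftrightarrow>
     continuous_on {0..\<sigma>} y0 \<and> continuous_on {0..\<sigma>} y1 \<and>
     cont_diff_on {0<..\<sigma>} y0 \<and> cont_diff_on {0<..\<sigma>} y1 \<and>
     (\<forall>t\<in>{0..\<sigma>}. y0 t < y1 t) \<and>
     continuous_on (closed_dom {0..\<sigma>} y0 y1) (\<lambda>(y, t). z y t) \<and>
     (\<forall>(y, t)\<in>closed_dom {0<..\<sigma>} y0 y1.
        (\<lambda>\<xi>. z \<xi> t) differentiable (at y within {y0 t..y1 t})) \<and>
     continuous_on (closed_dom {0<..\<sigma>} y0 y1) (\<lambda>(y, t). part_y y0 y1 z y t) \<and>
     (\<forall>(y, t)\<in>open_dom {0<..\<sigma>} y0 y1.
        (\<lambda>\<xi>. part_y y0 y1 z \<xi> t) differentiable (at y within {y0 t..y1 t}) \<and>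
        (\<lambda>\<tau>. z y \<tau>) differentiable (at t within {0..\<sigma>})) \<and>
     continuous_on (open_dom {0<..\<sigma>} y0 y1) (\<lambda>(y, t). part_yy y0 y1 z y t) \<and>
     continuous_on (open_dom {0<..\<sigma>} y0 y1) (\<lambda>(y, t). part_t \<sigma> z y t)"

text \<open>As \<open>integral\<close> is 0 for a non-integrable function, the existence of the integrals
  appearing in the free boundary formulas is required explicitly in both problems below,
  and likewise in the transformation.\<close>

definition V_problem ::
  "real \<Rightarrow> real \<Rightarrow> real \<Rightarrow> real \<Rightarrow> real \<Rightarrow> (real \<Rightarrow> real) \<Rightarrow> (real \<Rightarrow> real) \<Rightarrow>
   (real \<Rightarrow> real) \<Rightarrow> (real \<Rightarrow> real) \<Rightarrow> (real \<Rightarrow> real \<Rightarrow> real) \<Rightarrow> bool" where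
  "V_problem D \<beta> b \<sigma> C1 f u0 y0 y1 V \<longleftrightarrow>
     classical \<sigma> y0 y1 V \<and>
     (\<forall>(y, t)\<in>open_dom {0<..\<sigma>} y0 y1.
        part_t \<sigma> V y t = D * part_yy y0 y1 V y t - 2 * V y t * part_y y0 y1 V y t) \<and>
     (\<forall>t\<in>{0<..\<sigma>}.
        V (y0 t) t = f t - \<beta> \<and>
        V (y1 t) t = 0 \<and>
        D * (part_y y0 y1 V (y1 t) t / \<beta>) =
          (\<beta> * (1 - \<beta>) - \<beta> * time_deriv \<sigma> y1 t) / (\<beta> + 1)) \<and>
     (\<forall>y\<in>{C1..C2 u0 b C1}. V y 0 = V0 \<beta> u0 b C1 y) \<and>
     y0 0 = C1 \<and> y1 0 = C2 u0 b C1 \<and>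
     (\<lambda>\<tau>. f \<tau> - D * (part_y y0 y1 V (y0 \<tau>) \<tau> / f \<tau>)) integrable_on {0..\<sigma>} \<and>
     (\<lambda>\<tau>. part_y y0 y1 V (y1 \<tau>) \<tau>) integrable_on {0..\<sigma>} \<and>
     (\<forall>t\<in>{0..\<sigma>}.
        y0 t = C1 - 2 * \<beta> * t
               + integral {0..t} (\<lambda>\<tau>. f \<tau> - D * (part_y y0 y1 V (y0 \<tau>) \<tau> / f \<tau>)) \<and>
        y1 t = C2 u0 b C1 + (1 - \<beta>) * t
               - D * (\<beta> + 1) / \<beta>\<^sup>2 * integral {0..t} (\<lambda>\<tau>. part_y y0 y1 V (y1 \<tau>) \<tau>))"

definition C_fun ::
  "(real \<Rightarrow> real) \<Rightarrow> (real \<Rightarrow> real) \<Rightarrow> (real \<Rightarrow> real \<Rightarrow> real) \<Rightarrow> real \<Rightarrow> real" where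
  "C_fun y0 y1 w t = 1 - integral {0..t} (\<lambda>\<tau>. part_y y0 y1 w (y1 \<tau>) \<tau>)"

definition eta ::
  "real \<Rightarrow> (real \<Rightarrow> real) \<Rightarrow> (real \<Rightarrow> real \<Rightarrow> real) \<Rightarrow> real \<Rightarrow> real \<Rightarrow> real" where
  "eta D y1 V y t = exp (1 / D * integral {y..y1 t} (\<lambda>\<xi>. V \<xi> t))"

text \<open>The condition \<open>C_fun y0 y1 w t > 0\<close> makes the logarithm in the formula for
  \<open>y1\<close> meaningful.\<close>

definition w_problem ::
  "real \<Rightarrow> real \<Rightarrow> real \<Rightarrow> real \<Rightarrow> real \<Rightarrow> (real \<Rightarrow> real) \<Rightarrow> (real \<Rightarrow> real) \<Rightarrow>
   (real \<Rightarrow> real) \<Rightarrow> (real \<Rightarrow> real) \<Rightarrow> (real \<Rightarrow> real \<Rightarrow> real) \<Rightarrow> bool" where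
  "w_problem D \<beta> b \<sigma> C1 f u0 y0 y1 w \<longleftrightarrow>
     classical \<sigma> y0 y1 w \<and>
     (\<forall>(y, t)\<in>open_dom {0<..\<sigma>} y0 y1. part_t \<sigma> w y t = D * part_yy y0 y1 w y t) \<and>
     (\<forall>t\<in>{0<..\<sigma>}.
        w (y0 t) t =
          (f t - \<beta>) * (C_fun y0 y1 w t + 1 / D * integral {y0 t..y1 t} (\<lambda>\<xi>. w \<xi> t)) \<and>
        w (y1 t) t = 0 \<and>
        D * part_y y0 y1 w (y1 t) t / (\<beta> * C_fun y0 y1 w t) =
          (\<beta> * (1 - \<beta>) - \<beta> * time_deriv \<sigma> y1 t) / (\<beta> + 1)) \<and>
     (\<forall>y\<in>{C1..C2 u0 b C1}. w y 0 = F D \<beta> u0 b C1 y) \<and>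
     y0 0 = C1 \<and> y1 0 = C2 u0 b C1 \<and>
     (\<lambda>\<tau>. part_y y0 y1 w (y0 \<tau>) \<tau> / w (y0 \<tau>) \<tau> * (1 - \<beta> / f \<tau>)) integrable_on {0..\<sigma>} \<and>
     (\<lambda>\<tau>. part_y y0 y1 w (y1 \<tau>) \<tau>) integrable_on {0..\<sigma>} \<and>
     (\<forall>t\<in>{0..\<sigma>}. C_fun y0 y1 w t > 0) \<and>
     (\<forall>t\<in>{0..\<sigma>}.
        y0 t = C1 - \<beta>\<^sup>2 * integral {0..t} (\<lambda>\<tau>. 1 / f \<tau>)
               - D * integral {0..t}
                   (\<lambda>\<tau>. part_y y0 y1 w (y0 \<tau>) \<tau> / w (y0 \<tau>) \<tau> * (1 - \<beta> / f \<tau>)) \<and>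
        y1 t = C2 u0 b C1 + (1 - \<beta>) * t
               + D * (\<beta> + 1) / \<beta>\<^sup>2
                 * ln (1 - integral {0..t} (\<lambda>\<tau>. part_y y0 y1 w (y1 \<tau>) \<tau>)))"

text \<open>The transformation is a relation between \<open>V\<close> and \<open>w\<close>, because the factor
  \<open>C\<close> is itself defined through \<open>w\<close>.\<close>

definition transformed ::
  "real \<Rightarrow> real \<Rightarrow> (real \<Rightarrow> real) \<Rightarrow> (real \<Rightarrow> real) \<Rightarrow>
   (real \<Rightarrow> real \<Rightarrow> real) \<Rightarrow> (real \<Rightarrow> real \<Rightarrow> real) \<Rightarrow> bool" where
  "transformed D \<sigma> y0 y1 V w \<longleftrightarrow>
     (\<lambda>\<tau>. part_y y0 y1 w (y1 \<tau>) \<tau>) integrable_on {0..\<sigma>} \<and>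
     (\<forall>t\<in>{0..\<sigma>}. (\<lambda>\<xi>. V \<xi> t) integrable_on {y0 t..y1 t}) \<and>
     (\<forall>(y, t)\<in>closed_dom {0..\<sigma>} y0 y1. w y t = C_fun y0 y1 w t * V y t * eta D y1 V y t)"

end

theory Submission
  imports Defs
begin

text \<open>
  The transformation is a Hopf-Cole transformation with a moving reference point. Both directions
  revolve around one positive function \<open>Z\<close> with \<open>w = Z V\<close>, which can be written in terms of either
  unknown:
  \<open>Z = C \<eta>\<close> in terms of \<open>V\<close>, and \<open>Z = C + 1/D \<integral> w\<close>, integrated over \<open>[y, y\<^sub>1(t)]\<close>, in terms of \<open>w\<close>.
  The two expressions agree because both equal \<open>C\<close> at \<open>y = y\<^sub>1\<close> and have the space derivative
  \<open>- Z V / D = - w / D\<close>. The role of the factor \<open>C\<close> is to give the time derivative the equally simple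
  form \<open>Z\<^sub>t = - w\<^sub>y\<close>. With these two derivatives the product rule yields
  \<open>w\<^sub>y = Z (V\<^sub>y - V\<^sup>2 / D)\<close> and \<open>w\<^sub>t - D w\<^sub>y\<^sub>y = Z (V\<^sub>t - D V\<^sub>y\<^sub>y + 2 V V\<^sub>y)\<close>,
  and every condition of one problem turns into the corresponding condition of the other. In
  particular \<open>w\<^sub>y = C V\<^sub>y\<close> on \<open>y = y\<^sub>1\<close>, so that \<open>C' = - C V\<^sub>y(y\<^sub>1(t), t)\<close> and
  \<open>C = exp (- \<integral> V\<^sub>y(y\<^sub>1(\<tau>), \<tau>) d\<tau>)\<close>; this is where the logarithm in the formula for \<open>y\<^sub>1\<close> comes
  from, and it expresses \<open>C\<close> through \<open>V\<close>, although it is defined through \<open>w\<close>.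

  Three points need analysis rather than algebra.

  First, \<open>Z\<^sub>t\<close> involves the time derivative of \<open>\<integral> V\<close> (or \<open>\<integral> w\<close>) over \<open>[y, y\<^sub>1(t)]\<close>, while the time
  derivative of the unknown is continuous inside the domain only and may blow up at \<open>y\<^sub>1\<close>. Both
  equations are conservation laws, \<open>V\<^sub>t = (D V\<^sub>y - V\<^sup>2)\<^sub>y\<close> and \<open>w\<^sub>t = (D w\<^sub>y)\<^sub>y\<close>, whose fluxes are continuous
  up to the boundary. Together with the vanishing of the unknown on \<open>y\<^sub>1\<close> this gives the derivative:
  lemma \<open>has_derivative_integral_moving_endpoint\<close>.

  Secondly, the boundary slopes are continuous for \<open>t > 0\<close> but merely integrable, possibly only
  conditionally, near \<open>t = 0\<close>. All statements about \<open>C\<close> are therefore obtained from functions that are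
  continuous on \<open>[0, \<sigma>]\<close> and differentiable for \<open>t > 0\<close>.

  Thirdly, recovering \<open>V = w / Z\<close> from \<open>w\<close> requires \<open>Z > 0\<close>. This is where the sign of the initial
  data enters: as long as \<open>w \<ge> 0\<close>, the integral formula gives \<open>Z \<ge> C > 0\<close>, hence \<open>w = (f - \<beta>) Z > 0\<close>
  on \<open>y\<^sub>0\<close>; so \<open>w\<close> cannot vanish there at a first time, and the minimum principle for the heat equation
  keeps \<open>w \<ge> 0\<close> inside: lemma \<open>w_problem_denominator_pos\<close>.
\<close>

section \<open>Calculus with a singular initial time\<close>

text \<open>The integrand may be unbounded, and only conditionally integrable, near \<open>0\<close>; away from \<open>0\<close> the
  fundamental theorem applies as usual. Boundary slopes of classical solutions are of this kind.\<close>

lemma has_derivative_integral_from_singular_endpoint: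
  fixes p :: "real \<Rightarrow> real"
  assumes cont: "continuous_on {0<..\<sigma>} p" and int: "p integrable_on {0..\<sigma>}"
    and t: "t \<in> {0<..\<sigma>}"
  shows "((\<lambda>t. integral {0..t} p) has_real_derivative p t) (at t within {0..\<sigma>})"
proof -
  have "at t within {0..\<sigma>} = at t within {0<..\<sigma>}"
    by (rule at_within_nhd[of _ "{0<..}"]) (use t in auto)
  then have "continuous (at t within ({0..\<sigma>} - {})) p"
    using cont t by (simp add: continuous_on_eq_continuous_within)
  from integral_has_vector_derivative_continuous_at[OF int _ _ this]
  show ?thesis
    using t by (simp add: has_real_derivative_iff_has_vector_derivative)
qed

lemma has_integral_derivative_singular_endpoint:
  fixes h :: "real \<Rightarrow> real"
  assumes cont: "continuous_on {0..\<sigma>} h"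
    and der: "\<And>t. t \<in> {0<..\<sigma>} \<Longrightarrow> (h has_real_derivative h' t) (at t within {0..\<sigma>})"
    and t: "t \<in> {0..\<sigma>}"
  shows "(h' has_integral h t - h 0) {0..t}"
proof (rule fundamental_theorem_of_calculus_interior)
  show "continuous_on {0..t} h"
    using cont t by (auto intro: continuous_on_subset)
  fix x assume x: "x \<in> {0<..<t}"
  then have "at x within {0..\<sigma>} = at x"
    using t by (intro at_within_interior) auto
  then show "(h has_vector_derivative h' x) (at x)"
    using der[of x] x t by (simp add: has_real_derivative_iff_has_vector_derivative)
qed (use t in auto)

text \<open>\<open>K exp P\<close> has derivative \<open>0\<close> for \<open>t > 0\<close> and is continuous at \<open>0\<close>. This identifies the factor
  \<open>C\<close>, defined through \<open>w\<close>, with the exponential of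
  minus the integrated boundary slope of \<open>V\<close>.\<close>
lemma linear_ode_unique:
  fixes K :: "real \<Rightarrow> real"
  assumes contK: "continuous_on {0..\<sigma>} K" and contP: "continuous_on {0..\<sigma>} P"
    and K: "\<And>t. t \<in> {0<..\<sigma>} \<Longrightarrow> (K has_real_derivative - (K t * p t)) (at t within {0..\<sigma>})"
    and P: "\<And>t. t \<in> {0<..\<sigma>} \<Longrightarrow> (P has_real_derivative p t) (at t within {0..\<sigma>})"
    and init: "K 0 = 1" "P 0 = 0" and t: "t \<in> {0..\<sigma>}"
  shows "K t = exp (- P t)"
proof -
  have "((\<lambda>t. 0) has_integral (K t * exp (P t)) - (K 0 * exp (P 0))) {0..t}"
    by (rule has_integral_derivative_singular_endpoint[where \<sigma> = \<sigma>])
      (use t in \<open>auto intro!: continuous_intros contK contP derivative_eq_intros K P\<close>)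
  then have "K t * exp (P t) = 1"
    using init has_integral_unique[OF _ has_integral_0] by fastforce
  then show ?thesis
    by (simp add: exp_minus field_simps)
qed

section \<open>The exponential and the affine form of the multiplier\<close>

text \<open>At a fixed time this is the equality of the two expressions for \<open>Z\<close>, divided by \<open>C\<close>: the
  function \<open>\<eta>\<close> solves \<open>\<eta>' = - V \<eta> / D\<close> with \<open>\<eta> b = 1\<close>, and integrating this equation gives the
  second form.\<close>
lemma exp_tail_integral:
  fixes V :: "real \<Rightarrow> real"
  assumes D: "D \<noteq> 0" and cont: "continuous_on {a..b} V" and y: "y \<in> {a..b}"
  defines "\<eta> \<equiv> \<lambda>y. exp (1 / D * integral {y..b} V)"
  shows "(\<eta> has_real_derivative - (V y * \<eta> y / D)) (at y within {a..b})"
    and "\<eta> y = 1 + 1 / D * integral {y..b} (\<lambda>\<xi>. V \<xi> * \<eta> \<xi>)"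
proof -
  have der: "(\<eta> has_real_derivative - (V y * \<eta> y / D)) (at y within {a..b})"
    if "y \<in> {a..b}" for y
    unfolding \<eta>_def
    using D by (auto intro!: derivative_eq_intros integral_has_real_derivative' cont that)
  then show "(\<eta> has_real_derivative - (V y * \<eta> y / D)) (at y within {a..b})"
    using y .
  have "((\<lambda>\<xi>. V \<xi> * \<eta> \<xi>) has_integral (- D * \<eta> b) - (- D * \<eta> y)) {y..b}"
  proof (rule fundamental_theorem_of_calculus)
    fix x assume x: "x \<in> {y..b}"
    have "(\<eta> has_real_derivative - (V x * \<eta> x / D)) (at x within {y..b})"
      by (rule DERIV_subset[OF der]) (use x y in auto)
    from DERIV_cmult[OF this, of "- D"]
    show "((\<lambda>x. - D * \<eta> x) has_vector_derivative V x * \<eta> x) (at x within {y..b})"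
      using D by (simp add: has_real_derivative_iff_has_vector_derivative)
  qed (use y in auto)
  then have "integral {y..b} (\<lambda>\<xi>. V \<xi> * \<eta> \<xi>) = D * (\<eta> y - \<eta> b)"
    by (simp add: integral_unique algebra_simps)
  moreover have "\<eta> b = 1"
    by (simp add: \<eta>_def)
  ultimately show "\<eta> y = 1 + 1 / D * integral {y..b} (\<lambda>\<xi>. V \<xi> * \<eta> \<xi>)"
    using D by (simp add: field_simps)
qed

text \<open>The converse passage: starting from the affine form, \<open>w / Z = - D (ln Z)'\<close> is the function \<open>V\<close>
  whose exponential is \<open>Z\<close>.\<close>
lemma affine_tail_integral:
  fixes w :: "real \<Rightarrow> real"
  assumes D: "D \<noteq> 0" and K: "K > 0" and cont: "continuous_on {a..b} w" and y: "y \<in> {a..b}"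
  defines "Z \<equiv> \<lambda>y. K + 1 / D * integral {y..b} w"
  shows "(Z has_real_derivative - (w y / D)) (at y within {a..b})"
    and "(\<And>y. y \<in> {a..b} \<Longrightarrow> Z y > 0) \<Longrightarrow>
      exp (1 / D * integral {y..b} (\<lambda>\<xi>. w \<xi> / Z \<xi>)) = Z y / K"
proof -
  have der: "(Z has_real_derivative - (w y / D)) (at y within {a..b})"
    if "y \<in> {a..b}" for y
    unfolding Z_def
    using D by (auto intro!: derivative_eq_intros integral_has_real_derivative' cont that)
  then show "(Z has_real_derivative - (w y / D)) (at y within {a..b})"
    using y .
  assume pos: "\<And>y. y \<in> {a..b} \<Longrightarrow> Z y > 0"
  have "((\<lambda>\<xi>. w \<xi> / Z \<xi>) has_integral (- D * ln (Z b)) - (- D * ln (Z y))) {y..b}"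
  proof (rule fundamental_theorem_of_calculus)
    fix x assume x: "x \<in> {y..b}"
    have "(Z has_real_derivative - (w x / D)) (at x within {y..b})"
      by (rule DERIV_subset[OF der]) (use x y in auto)
    then have "((\<lambda>x. - D * ln (Z x)) has_real_derivative w x / Z x) (at x within {y..b})"
      using D pos[of x] x y by (auto intro!: derivative_eq_intros simp: field_simps)
    then show "((\<lambda>x. - D * ln (Z x)) has_vector_derivative w x / Z x) (at x within {y..b})"
      by (simp add: has_real_derivative_iff_has_vector_derivative)
  qed (use y in auto)
  then have "1 / D * integral {y..b} (\<lambda>\<xi>. w \<xi> / Z \<xi>) = ln (Z y) - ln (Z b)"
    using D by (simp add: integral_unique field_simps)
  moreover have "Z b = K"
    by (simp add: Z_def)
  ultimately show "exp (1 / D * integral {y..b} (\<lambda>\<xi>. w \<xi> / Z \<xi>)) = Z y / K"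
    using pos[OF y] K by (simp add: exp_diff)
qed

section \<open>Flux through a moving endpoint\<close>

text \<open>For the conservation law \<open>z\<^sub>t = \<Phi>\<^sub>y\<close> the mass between \<open>y\<close> and \<open>y1\<close> changes by the difference of the
  fluxes; there is no term with the velocity of \<open>y1\<close>, because \<open>z\<close> vanishes at \<open>(y1 t, t)\<close>. The
  Leibniz rule does not apply up to \<open>y1\<close>, since \<open>zt\<close> is controlled in the interior only. For a time
  increment \<open>h\<close> one therefore cuts the interval at \<open>a = y1 t - (L + 1) h\<close>, where \<open>L\<close> is a Lipschitz
  constant of \<open>y1\<close> at \<open>t\<close>. Left of \<open>a\<close> the Leibniz rule holds during the whole time step, and the flux
  at \<open>a\<close> is close to the one at \<open>y1\<close>. The piece right of \<open>a\<close> has length \<open>O(h)\<close>, and \<open>z\<close> is small on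
  it, so that it contributes \<open>o(h)\<close>.\<close>
lemma has_derivative_integral_moving_endpoint:
  fixes z \<Phi> zt :: "real \<Rightarrow> real \<Rightarrow> real"
  assumes t: "t \<in> {0<..\<sigma>}" and y: "y0 t < y" "y < y1 t"
    and contb: "continuous_on {0..\<sigma>} y0"
    and y1: "(y1 has_real_derivative c) (at t within {0..\<sigma>})"
    and contz: "continuous_on (closed_dom {0<..\<sigma>} y0 y1) (\<lambda>(y, t). z y t)"
    and cont\<Phi>: "continuous_on (closed_dom {0<..\<sigma>} y0 y1) (\<lambda>(y, t). \<Phi> y t)"
    and contzt: "continuous_on (open_dom {0<..\<sigma>} y0 y1) (\<lambda>(y, t). zt y t)"
    and zt: "\<And>x s. (x, s) \<in> open_dom {0<..\<sigma>} y0 y1 \<Longrightarrow>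
      ((\<lambda>\<tau>. z x \<tau>) has_real_derivative zt x s) (at s within {0..\<sigma>})"
    and \<Phi>y: "\<And>x s. (x, s) \<in> open_dom {0<..\<sigma>} y0 y1 \<Longrightarrow>
      ((\<lambda>\<xi>. \<Phi> \<xi> s) has_real_derivative zt x s) (at x within {y0 s..y1 s})"
    and zero: "z (y1 t) t = 0"
  shows "((\<lambda>s. integral {y..y1 s} (\<lambda>\<xi>. z \<xi> s)) has_real_derivative
    \<Phi> (y1 t) t - \<Phi> y t) (at t within {0..\<sigma>})"
  unfolding has_field_derivative_def has_derivative_within_alt
proof (intro conjI bounded_linear_mult_right allI impI)
  fix e :: real assume e: "e > 0"
  define S where "S = {0..\<sigma>}"
  define dom where "dom = closed_dom {0<..\<sigma>} y0 y1"
  define L where "L = \<bar>c\<bar> + 1"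
  \<comment> \<open>The total error will be \<open>2 \<omega> h\<close> from the two fluxes and \<open>(2 L + 1) \<omega> h\<close> from each of the two
    boundary pieces, together \<open>(4 L + 4) \<omega> h\<close>.\<close>
  define \<omega> where "\<omega> = e / (4 * L + 4)"
  have L: "L > 0" by (simp add: L_def add_nonneg_pos)
  then have \<omega>: "\<omega> > 0" using e by (simp add: \<omega>_def)
  have tS: "t \<in> S" using t by (simp add: S_def)
  \<comment> \<open>Differentiability at the single time \<open>t\<close> is enough for a Lipschitz bound based at \<open>t\<close>.\<close>
  have lip: "\<forall>\<^sub>F s in at t within S. \<bar>y1 s - y1 t\<bar> \<le> L * \<bar>s - t\<bar>"
  proof -
    from y1 have "\<forall>e>0. \<exists>d>0. \<forall>s\<in>S. norm (s - t) < d \<longrightarrow>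
        norm (y1 s - y1 t - c * (s - t)) \<le> e * norm (s - t)"
      unfolding has_field_derivative_def has_derivative_within_alt S_def by blast
    then obtain d where d: "d > 0" "\<And>s. s \<in> S \<Longrightarrow> \<bar>s - t\<bar> < d \<Longrightarrow>
        \<bar>y1 s - y1 t - c * (s - t)\<bar> \<le> 1 * \<bar>s - t\<bar>"
      by (metis real_norm_def zero_less_one)
    have "\<bar>y1 s - y1 t\<bar> \<le> L * \<bar>s - t\<bar>" if "s \<in> S" "\<bar>s - t\<bar> < d" for s
    proof -
      have "\<bar>y1 s - y1 t\<bar> \<le> \<bar>y1 s - y1 t - c * (s - t)\<bar> + \<bar>c * (s - t)\<bar>" by linarith
      also have "\<dots> \<le> 1 * \<bar>s - t\<bar> + \<bar>c\<bar> * \<bar>s - t\<bar>"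
        using d(2)[OF that] by (intro add_mono) (auto simp: abs_mult)
      finally show ?thesis by (simp add: L_def algebra_simps)
    qed
    then show ?thesis
      unfolding eventually_at dist_real_def using d(1) by blast
  qed
  have low: "\<forall>\<^sub>F s in at t within S. y0 s < y"
  proof -
    have "(y0 \<longlongrightarrow> y0 t) (at t within S)"
      using contb tS by (simp add: S_def continuous_on_def)
    then show ?thesis using y(1) by (rule order_tendstoD)
  qed
  have pos: "\<forall>\<^sub>F s in at t within S. s > 0"
    using t by (intro order_tendstoD(1)[OF tendsto_ident_at]) auto
  obtain d0 where d0: "d0 > 0" and near0: "\<And>s. s \<in> S \<Longrightarrow> \<bar>s - t\<bar> < d0 \<Longrightarrow>
      \<bar>y1 s - y1 t\<bar> \<le> L * \<bar>s - t\<bar> \<and> y0 s < y \<and> s > 0"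
  proof -
    have "\<forall>\<^sub>F s in at t within S. \<bar>y1 s - y1 t\<bar> \<le> L * \<bar>s - t\<bar> \<and> y0 s < y \<and> s > 0"
      using lip low pos by eventually_elim simp
    then obtain d where "d > 0" "\<And>s. s \<in> S \<Longrightarrow> s \<noteq> t \<Longrightarrow> dist s t < d \<Longrightarrow>
      \<bar>y1 s - y1 t\<bar> \<le> L * \<bar>s - t\<bar> \<and> y0 s < y \<and> s > 0"
      unfolding eventually_at by blast
    moreover have "\<bar>y1 t - y1 t\<bar> \<le> L * \<bar>t - t\<bar> \<and> y0 t < y \<and> t > 0"
      using y t by simp
    ultimately show thesis
      using that[of d] by (metis dist_real_def)
  qed
  have corner: "(y1 t, t) \<in> dom" and pt: "(y, t) \<in> dom"
    using t y by (auto simp: dom_def closed_dom_def)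
  have modulus: "\<exists>r>0. \<forall>x s. (x, s) \<in> dom \<longrightarrow> \<bar>x - x0\<bar> + \<bar>s - t\<bar> < r \<longrightarrow> \<bar>G x s - G x0 t\<bar> < \<omega>"
    if contG: "continuous_on dom (\<lambda>(x, s). G x s)" and x0: "(x0, t) \<in> dom" for G :: "real \<Rightarrow> real \<Rightarrow> real" and x0
  proof -
    obtain r where r: "r > 0" "\<And>p. p \<in> dom \<Longrightarrow> dist p (x0, t) < r \<Longrightarrow>
        dist ((\<lambda>(x, s). G x s) p) (G x0 t) < \<omega>"
      using contG[unfolded continuous_on_iff, rule_format, OF x0 \<omega>]
      by (metis (no_types, lifting) case_prod_conv)
    have "\<bar>G x s - G x0 t\<bar> < \<omega>" if "(x, s) \<in> dom" "\<bar>x - x0\<bar> + \<bar>s - t\<bar> < r" for x s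
    proof -
      have "dist (x, s) (x0, t) \<le> \<bar>x - x0\<bar> + \<bar>s - t\<bar>"
        unfolding dist_Pair_Pair dist_real_def by (rule sqrt_sum_squares_le_sum) auto
      then show ?thesis using r(2)[OF that(1)] that(2) by (simp add: dist_real_def)
    qed
    then show ?thesis using r(1) by blast
  qed
  obtain r1 where r1: "r1 > 0" "\<And>x s. (x, s) \<in> dom \<Longrightarrow> \<bar>x - y1 t\<bar> + \<bar>s - t\<bar> < r1 \<Longrightarrow>
      \<bar>\<Phi> x s - \<Phi> (y1 t) t\<bar> < \<omega>"
    using modulus[of \<Phi>, OF _ corner] cont\<Phi> unfolding dom_def by blast
  obtain r2 where r2: "r2 > 0" "\<And>x s. (x, s) \<in> dom \<Longrightarrow> \<bar>x - y\<bar> + \<bar>s - t\<bar> < r2 \<Longrightarrow>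
      \<bar>\<Phi> x s - \<Phi> y t\<bar> < \<omega>"
    using modulus[of \<Phi>, OF _ pt] cont\<Phi> unfolding dom_def by blast
  obtain r3 where r3: "r3 > 0" "\<And>x s. (x, s) \<in> dom \<Longrightarrow> \<bar>x - y1 t\<bar> + \<bar>s - t\<bar> < r3 \<Longrightarrow>
      \<bar>z x s\<bar> < \<omega>"
    using modulus[of z, OF _ corner] contz zero unfolding dom_def by auto
  define d where "d = Min {d0, (y1 t - y) / (L + 1), r1 / (L + 2), r2, r3 / (L + 2)}"
  have d: "d > 0" "d \<le> d0" "(L + 1) * d \<le> y1 t - y" "(L + 2) * d \<le> r1" "d \<le> r2" "(L + 2) * d \<le> r3"
  proof -
    show "d > 0" using d0 r1(1) r2(1) r3(1) y L by (simp add: d_def)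
    show "d \<le> d0" "d \<le> r2" by (simp_all add: d_def)
    have "d \<le> (y1 t - y) / (L + 1)" "d \<le> r1 / (L + 2)" "d \<le> r3 / (L + 2)"
      by (simp_all add: d_def)
    then show "(L + 1) * d \<le> y1 t - y" "(L + 2) * d \<le> r1" "(L + 2) * d \<le> r3"
      using L by (simp_all add: field_simps)
  qed
  have "norm (integral {y..y1 s} (\<lambda>\<xi>. z \<xi> s) - integral {y..y1 t} (\<lambda>\<xi>. z \<xi> t)
        - (\<Phi> (y1 t) t - \<Phi> y t) * (s - t)) \<le> e * norm (s - t)"
    if s: "s \<in> {0..\<sigma>}" "norm (s - t) < d" for s
  proof (cases "s = t")
    case False
    define h where "h = \<bar>s - t\<bar>"
    have h: "h > 0" "h < d" using False s by (auto simp: h_def)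
    define a where "a = y1 t - (L + 1) * h"
    define U where "U = {min t s..max t s}"
    have near: "\<tau> \<in> {0<..\<sigma>} \<and> y0 \<tau> < y \<and> a < y1 \<tau> \<and> \<bar>\<tau> - t\<bar> \<le> h \<and> \<bar>y1 \<tau> - y1 t\<bar> \<le> L * h"
      if "\<tau> \<in> U" for \<tau>
    proof -
      have \<tau>: "\<tau> \<in> S" "\<bar>\<tau> - t\<bar> \<le> h"
        using that s t by (auto simp: U_def S_def h_def min_def max_def split: if_splits)
      then have "\<bar>\<tau> - t\<bar> < d0" using h d by linarith
      from near0[OF \<tau>(1) this] have n: "\<bar>y1 \<tau> - y1 t\<bar> \<le> L * \<bar>\<tau> - t\<bar>" "y0 \<tau> < y" "\<tau> > 0" by auto
      have "L * \<bar>\<tau> - t\<bar> \<le> L * h" using \<tau> L by (intro mult_left_mono) auto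
      then have "\<bar>y1 \<tau> - y1 t\<bar> \<le> L * h" using n by linarith
      moreover then have "a < y1 \<tau>" using h by (simp add: a_def algebra_simps)
      ultimately show ?thesis using n \<tau> by (auto simp: S_def)
    qed
    have ya: "y < a"
    proof -
      have "(L + 1) * h < (L + 1) * d" using h L by (intro mult_strict_left_mono) auto
      then show ?thesis using d(3) by (simp add: a_def)
    qed
    have opn: "(x, \<tau>) \<in> open_dom {0<..\<sigma>} y0 y1" if "\<tau> \<in> U" "x \<in> {y..a}" for x \<tau>
      using near[OF that(1)] that(2) by (auto simp: open_dom_def)
    have contz': "continuous_on {y..y1 \<tau>} (\<lambda>\<xi>. z \<xi> \<tau>)" if "\<tau> \<in> U" for \<tau>
      using near[OF that]
      by (intro continuous_on_compose2[OF contz, of _ "\<lambda>\<xi>. (\<xi>, \<tau>)", simplified])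
        (auto intro!: continuous_intros simp: closed_dom_def)
    define A where "A \<tau> = integral {y..a} (\<lambda>\<xi>. z \<xi> \<tau>)" for \<tau>
    define R where "R \<tau> = integral {a..y1 \<tau>} (\<lambda>\<xi>. z \<xi> \<tau>)" for \<tau>
    have split: "integral {y..y1 \<tau>} (\<lambda>\<xi>. z \<xi> \<tau>) = A \<tau> + R \<tau>" if "\<tau> \<in> U" for \<tau>
      unfolding A_def R_def
      by (rule Henstock_Kurzweil_Integration.integral_combine[symmetric])
        (use ya near[OF that] contz'[OF that] in \<open>auto intro: integrable_continuous_real\<close>)
    have R: "\<bar>R \<tau>\<bar> \<le> \<omega> * ((2 * L + 1) * h)" if \<tau>: "\<tau> \<in> U" for \<tau>
    proof -
      have "norm (R \<tau>) \<le> \<omega> * (y1 \<tau> - a)"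
        unfolding R_def
      proof (rule integral_bound)
        show "a \<le> y1 \<tau>" using near[OF \<tau>] by simp
        show "continuous_on {a..y1 \<tau>} (\<lambda>\<xi>. z \<xi> \<tau>)"
          using contz'[OF \<tau>] ya by (auto intro: continuous_on_subset)
        fix \<xi> assume \<xi>: "\<xi> \<in> {a..y1 \<tau>}"
        have "\<bar>\<xi> - y1 t\<bar> \<le> (L + 1) * h"
          using \<xi> near[OF \<tau>] h by (auto simp: a_def abs_le_iff algebra_simps)
        moreover have "(L + 2) * h < (L + 2) * d" using h L by (intro mult_strict_left_mono) auto
        ultimately have "\<bar>\<xi> - y1 t\<bar> + \<bar>\<tau> - t\<bar> < r3"
          using near[OF \<tau>] d(6) by (simp add: algebra_simps)
        moreover have "(\<xi>, \<tau>) \<in> dom"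
          using \<xi> near[OF \<tau>] ya by (auto simp: dom_def closed_dom_def)
        ultimately show "norm (z \<xi> \<tau>) \<le> \<omega>" using r3(2) by fastforce
      qed
      also have "\<dots> \<le> \<omega> * ((2 * L + 1) * h)"
        using near[OF \<tau>] \<omega> h by (intro mult_left_mono) (auto simp: a_def algebra_simps)
      finally show ?thesis by simp
    qed
    have A: "(A has_real_derivative \<Phi> a \<tau> - \<Phi> y \<tau>) (at \<tau> within U)" if \<tau>: "\<tau> \<in> U" for \<tau>
    proof -
      have "((\<lambda>\<tau>. integral (cbox y a) (\<lambda>\<xi>. z \<xi> \<tau>)) has_real_derivative
          integral (cbox y a) (\<lambda>\<xi>. zt \<xi> \<tau>)) (at \<tau> within U)"
      proof (rule leibniz_rule_field_derivative[where fx = "\<lambda>\<tau> \<xi>. zt \<xi> \<tau>"])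
        fix \<tau> \<xi> assume *: "\<tau> \<in> U" "\<xi> \<in> cbox y a"
        have "U \<subseteq> {0..\<sigma>}" using near by fastforce
        then show "((\<lambda>\<tau>. z \<xi> \<tau>) has_real_derivative zt \<xi> \<tau>) (at \<tau> within U)"
          using zt[OF opn] * by (auto intro: DERIV_subset)
      next
        fix \<tau> assume *: "\<tau> \<in> U"
        show "(\<lambda>\<xi>. z \<xi> \<tau>) integrable_on cbox y a"
          using contz'[OF *] near[OF *]
          by (auto intro!: integrable_continuous_real elim!: continuous_on_subset)
      next
        show "continuous_on (U \<times> cbox y a) (\<lambda>(\<tau>, \<xi>). zt \<xi> \<tau>)"
          using continuous_on_compose2[OF contzt, of "U \<times> cbox y a" "\<lambda>p. (snd p, fst p)"]
          by (force simp: case_prod_beta intro!: continuous_intros opn)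
      qed (use \<tau> in \<open>auto simp: U_def\<close>)
      moreover have "((\<lambda>\<xi>. zt \<xi> \<tau>) has_integral \<Phi> a \<tau> - \<Phi> y \<tau>) {y..a}"
      proof (rule fundamental_theorem_of_calculus)
        fix \<xi> assume \<xi>: "\<xi> \<in> {y..a}"
        have "((\<lambda>\<xi>. \<Phi> \<xi> \<tau>) has_real_derivative zt \<xi> \<tau>) (at \<xi> within {y..a})"
          by (rule DERIV_subset[OF \<Phi>y[OF opn[OF \<tau> \<xi>]]]) (use near[OF \<tau>] in auto)
        then show "((\<lambda>\<xi>. \<Phi> \<xi> \<tau>) has_vector_derivative zt \<xi> \<tau>) (at \<xi> within {y..a})"
          by (simp add: has_real_derivative_iff_has_vector_derivative)
      qed (use ya in simp)
      ultimately show ?thesis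
        by (simp add: A_def[abs_def] integral_unique)
    qed
    define k where "k = \<Phi> (y1 t) t - \<Phi> y t"
    \<comment> \<open>Mean value inequality: the derivative of \<open>A\<close> stays within \<open>2 \<omega>\<close> of the constant \<open>k\<close>.\<close>
    have "norm ((A s - k * s) - (A t - k * t)) \<le> 2 * \<omega> * norm (s - t)"
    proof (rule field_differentiable_bound[where S = U and f' = "\<lambda>\<tau>. \<Phi> a \<tau> - \<Phi> y \<tau> - k"])
      fix \<tau> assume \<tau>: "\<tau> \<in> U"
      show "((\<lambda>\<tau>. A \<tau> - k * \<tau>) has_real_derivative \<Phi> a \<tau> - \<Phi> y \<tau> - k) (at \<tau> within U)"
        by (auto intro!: derivative_eq_intros A[OF \<tau>])
      have "(L + 2) * h < (L + 2) * d" using h L by (intro mult_strict_left_mono) auto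
      moreover have "\<bar>a - y1 t\<bar> = (L + 1) * h"
        using h L by (simp add: a_def abs_mult)
      ultimately have "\<bar>a - y1 t\<bar> + \<bar>\<tau> - t\<bar> < r1"
        using near[OF \<tau>] d(4) by (simp add: algebra_simps)
      moreover have "\<bar>y - y\<bar> + \<bar>\<tau> - t\<bar> < r2" using near[OF \<tau>] d(5) h by simp
      moreover have "(a, \<tau>) \<in> dom" "(y, \<tau>) \<in> dom"
        using near[OF \<tau>] ya by (auto simp: dom_def closed_dom_def)
      ultimately have "\<bar>\<Phi> a \<tau> - \<Phi> (y1 t) t\<bar> < \<omega>" "\<bar>\<Phi> y \<tau> - \<Phi> y t\<bar> < \<omega>"
        using r1(2) r2(2) by blast+
      then show "norm (\<Phi> a \<tau> - \<Phi> y \<tau> - k) \<le> 2 * \<omega>"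
        by (simp add: k_def)
    qed (auto simp: U_def)
    then have "\<bar>A s - A t - k * (s - t)\<bar> \<le> 2 * \<omega> * h"
      by (simp add: h_def algebra_simps)
    moreover have "\<bar>R s\<bar> \<le> \<omega> * ((2 * L + 1) * h)" "\<bar>R t\<bar> \<le> \<omega> * ((2 * L + 1) * h)"
      by (auto intro!: R simp: U_def)
    ultimately have "\<bar>(A s + R s) - (A t + R t) - k * (s - t)\<bar>
        \<le> 2 * \<omega> * h + 2 * (\<omega> * ((2 * L + 1) * h))"
      by linarith
    also have "\<dots> = \<omega> * (4 * L + 4) * h" by (simp add: algebra_simps)
    also have "\<dots> = e * h" using L by (simp add: \<omega>_def)
    finally show ?thesis
      using split[of s] split[of t] by (simp add: U_def k_def h_def)
  qed simp
  then show "\<exists>d>0. \<forall>s\<in>{0..\<sigma>}. norm (s - t) < d \<longrightarrow>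
      norm (integral {y..y1 s} (\<lambda>\<xi>. z \<xi> s) - integral {y..y1 t} (\<lambda>\<xi>. z \<xi> t)
        - (\<Phi> (y1 t) t - \<Phi> y t) * (s - t)) \<le> e * norm (s - t)"
    using d(1) by blast
qed

section \<open>The moving domain and classical functions on it\<close>

lemma compact_closed_dom:
  assumes "continuous_on {0..T} y0" "continuous_on {0..T} y1" "\<And>t. t \<in> {0..T} \<Longrightarrow> y0 t \<le> y1 t"
  shows "compact (closed_dom {0..T} y0 y1)"
proof -
  have "closed_dom {0..T} y0 y1 =
      (\<lambda>(\<theta>, t). (y0 t + \<theta> * (y1 t - y0 t), t)) ` ({0..1} \<times> {0..T})" (is "_ = ?h ` _")
  proof (intro equalityI subsetI)
    fix p assume "p \<in> closed_dom {0..T} y0 y1"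
    then obtain y t where p: "p = (y, t)" "t \<in> {0..T}" "y0 t \<le> y" "y \<le> y1 t"
      by (auto simp: closed_dom_def)
    define \<theta> where "\<theta> = (if y0 t = y1 t then 0 else (y - y0 t) / (y1 t - y0 t))"
    have "p = ?h (\<theta>, t)" "\<theta> \<in> {0..1}"
      using p by (auto simp: \<theta>_def field_simps)
    then show "p \<in> ?h ` ({0..1} \<times> {0..T})"
      using p(2) by blast
  next
    fix p assume "p \<in> ?h ` ({0..1} \<times> {0..T})"
    then obtain q where "p = ?h q" "q \<in> {0..1} \<times> {0..T}"
      by (rule imageE)
    moreover obtain \<theta> t where "q = (\<theta>, t)"
      by (rule prod.exhaust)
    ultimately have p: "p = (y0 t + \<theta> * (y1 t - y0 t), t)" "t \<in> {0..T}" "0 \<le> \<theta>" "\<theta> \<le> 1"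
      by auto
    have "\<theta> * (y1 t - y0 t) \<le> 1 * (y1 t - y0 t)"
      using p assms(3)[OF p(2)] by (intro mult_right_mono) auto
    then show "p \<in> closed_dom {0..T} y0 y1"
      using p assms(3)[OF p(2)] by (auto simp: closed_dom_def)
  qed
  moreover have "compact (?h ` ({0..1} \<times> {0..T}))"
  proof -
    have "continuous_on ({0..1} \<times> {0..T}) (\<lambda>p. y0 (snd p))"
      by (rule continuous_on_compose2[OF assms(1) continuous_on_snd[OF continuous_on_id]]) auto
    moreover have "continuous_on ({0..1} \<times> {0..T}) (\<lambda>p. y1 (snd p))"
      by (rule continuous_on_compose2[OF assms(2) continuous_on_snd[OF continuous_on_id]]) auto
    ultimately have "continuous_on ({0..1} \<times> {0..T}) ?h"
      unfolding case_prod_beta by (intro continuous_intros)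
    then show ?thesis
      by (rule compact_continuous_image) (intro compact_Times compact_Icc)
  qed
  ultimately show ?thesis
    by simp
qed

text \<open>The substitution \<open>\<xi> = y + \<theta> (y1 t - y)\<close> turns the variable interval of integration into
  \<open>[0, 1]\<close>, and the integrand into a jointly continuous function of \<open>(y, t)\<close> and \<open>\<theta>\<close>.\<close>
lemma continuous_on_tail_integral:
  fixes z :: "real \<Rightarrow> real \<Rightarrow> real"
  assumes z: "continuous_on (closed_dom I y0 y1) (\<lambda>(y, t). z y t)" and y1: "continuous_on I y1"
  shows "continuous_on (closed_dom I y0 y1) (\<lambda>(y, t). integral {y..y1 t} (\<lambda>\<xi>. z \<xi> t))"
proof -
  let ?m = "\<lambda>p. y1 (snd p) - fst p"
  have cm: "continuous_on (closed_dom I y0 y1) ?m"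
    by (intro continuous_on_diff continuous_on_fst continuous_on_id
        continuous_on_compose2[OF y1 continuous_on_snd[OF continuous_on_id]])
      (auto simp: closed_dom_def)
  have "continuous_on (closed_dom I y0 y1)
      (\<lambda>p. ?m p * integral (cbox 0 1) (\<lambda>\<theta>. z (?m p * \<theta> + fst p) (snd p)))"
  proof (rule continuous_on_mult[OF cm integral_continuous_on_param])
    have "continuous_on (closed_dom I y0 y1 \<times> cbox 0 1)
        (\<lambda>q. (\<lambda>(y, t). z y t) (?m (fst q) * snd q + fst (fst q), snd (fst q)))"
    proof (rule continuous_on_compose2[OF z])
      show "continuous_on (closed_dom I y0 y1 \<times> cbox 0 1)
          (\<lambda>q. (?m (fst q) * snd q + fst (fst q), snd (fst q)))"
        by (intro continuous_intros
            continuous_on_compose2[OF cm continuous_on_fst[OF continuous_on_id]]) auto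
      have "y0 t \<le> (y1 t - y) * \<theta> + y \<and> (y1 t - y) * \<theta> + y \<le> y1 t"
        if "y0 t \<le> y" "y \<le> y1 t" "0 \<le> \<theta>" "\<theta> \<le> 1" for y t \<theta> :: real
      proof -
        have "0 \<le> (y1 t - y) * \<theta>" using that by (intro mult_nonneg_nonneg) auto
        moreover have "(y1 t - y) * \<theta> \<le> y1 t - y"
          using that mult_left_mono[of \<theta> 1 "y1 t - y"] by simp
        ultimately show ?thesis using that by (intro conjI) linarith+
      qed
      then show "(\<lambda>q. (?m (fst q) * snd q + fst (fst q), snd (fst q))) `
          (closed_dom I y0 y1 \<times> cbox 0 1) \<subseteq> closed_dom I y0 y1"
        by (auto simp: closed_dom_def)
    qed
    then show "continuous_on (closed_dom I y0 y1 \<times> cbox 0 1)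
        (\<lambda>(p, \<theta>). z (?m p * \<theta> + fst p) (snd p))"
      by (simp add: case_prod_beta)
  qed
  then show ?thesis
  proof (rule continuous_on_eq)
    fix p assume "p \<in> closed_dom I y0 y1"
    then obtain y t where p: "p = (y, t)" "t \<in> I" "y0 t \<le> y" "y \<le> y1 t"
      by (auto simp: closed_dom_def)
    have "(y1 t - y) * integral (cbox 0 1) (\<lambda>\<theta>. z ((y1 t - y) * \<theta> + y) t)
        = integral {y..y1 t} (\<lambda>\<xi>. z \<xi> t)"
    proof (cases "y = y1 t")
      case False
      have "continuous_on {y..y1 t} (\<lambda>\<xi>. z \<xi> t)"
        using p by (intro continuous_on_compose2[OF z, of _ "\<lambda>\<xi>. (\<xi>, t)", simplified])
          (auto intro!: continuous_intros simp: closed_dom_def)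
      then have "((\<lambda>\<xi>. z \<xi> t) has_integral integral {y..y1 t} (\<lambda>\<xi>. z \<xi> t)) (cbox y (y1 t))"
        by (simp add: integrable_continuous_real integrable_integral)
      from has_integral_affinity'[OF this, of "y1 t - y" y] False p
      have "((\<lambda>\<theta>. z ((y1 t - y) * \<theta> + y) t) has_integral
          integral {y..y1 t} (\<lambda>\<xi>. z \<xi> t) / (y1 t - y)) (cbox 0 1)"
        by (simp add: divide_inverse mult.commute)
      from integral_unique[OF this] False show ?thesis
        by simp
    qed simp
    then show "?m p * integral (cbox 0 1) (\<lambda>\<theta>. z (?m p * \<theta> + fst p) (snd p)) =
        (case p of (y, t) \<Rightarrow> integral {y..y1 t} (\<lambda>\<xi>. z \<xi> t))"
      by (simp add: p(1))
  qed
qed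

lemma open_dom_subset: "open_dom I y0 y1 \<subseteq> closed_dom I y0 y1"
  by (auto simp: open_dom_def closed_dom_def)

lemma closed_dom_mono: "I \<subseteq> J \<Longrightarrow> closed_dom I y0 y1 \<subseteq> closed_dom J y0 y1"
  by (auto simp: closed_dom_def)

text \<open>Time derivatives at an interior point see only values of the function on the domain.\<close>
lemma open_dom_stable_in_time:
  assumes "(y, t) \<in> open_dom {0<..\<sigma>} y0 y1" and "continuous_on {0..\<sigma>} y0" "continuous_on {0..\<sigma>} y1"
  obtains d where "d > 0"
    "\<And>\<tau>. \<tau> \<in> {0..\<sigma>} \<Longrightarrow> dist \<tau> t < d \<Longrightarrow> (y, \<tau>) \<in> open_dom {0<..\<sigma>} y0 y1"
proof -
  have t: "t \<in> {0<..\<sigma>}" "y0 t < y" "y < y1 t"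
    using assms(1) by (auto simp: open_dom_def)
  have "\<forall>\<^sub>F \<tau> in at t within {0..\<sigma>}. 0 < \<tau> \<and> y0 \<tau> < y \<and> y < y1 \<tau>"
    using t assms(2,3)
    by (intro eventually_conj order_tendstoD(1)[OF tendsto_ident_at]
        order_tendstoD[of y0 "y0 t"] order_tendstoD[of y1 "y1 t"])
      (auto simp: continuous_on_def)
  then obtain d where "d > 0" "\<And>\<tau>. \<tau> \<in> {0..\<sigma>} \<Longrightarrow> \<tau> \<noteq> t \<Longrightarrow> dist \<tau> t < d \<Longrightarrow>
      0 < \<tau> \<and> y0 \<tau> < y \<and> y < y1 \<tau>"
    unfolding eventually_at by blast
  then show thesis
    using t by (intro that[of d]) (auto simp: open_dom_def)
qed

lemma DERIV_from_differentiable: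
  fixes h :: "real \<Rightarrow> real"
  assumes "h differentiable (at x within S)"
  shows "(h has_real_derivative vector_derivative h (at x within S)) (at x within S)"
  using assms
  by (simp add: has_real_derivative_iff_has_vector_derivative flip: vector_derivative_works)

lemma vector_derivative_real_within:
  fixes h :: "real \<Rightarrow> real"
  assumes "(h has_real_derivative d) (at x within {a..b})" "a < b" "x \<in> {a..b}"
  shows "vector_derivative h (at x within {a..b}) = d"
  using assms vector_derivative_within_closed_interval
  by (simp add: has_real_derivative_iff_has_vector_derivative)

lemma classicalD:
  assumes "classical \<sigma> y0 y1 z"
  shows "continuous_on {0..\<sigma>} y0" and "continuous_on {0..\<sigma>} y1"
    and "t \<in> {0..\<sigma>} \<Longrightarrow> y0 t < y1 t"
    and "continuous_on (closed_dom {0..\<sigma>} y0 y1) (\<lambda>(y, t). z y t)"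
    and "(y, t) \<in> closed_dom {0<..\<sigma>} y0 y1 \<Longrightarrow>
      ((\<lambda>\<xi>. z \<xi> t) has_real_derivative part_y y0 y1 z y t) (at y within {y0 t..y1 t})"
    and "continuous_on (closed_dom {0<..\<sigma>} y0 y1) (\<lambda>(y, t). part_y y0 y1 z y t)"
    and "(y, t) \<in> open_dom {0<..\<sigma>} y0 y1 \<Longrightarrow>
      ((\<lambda>\<xi>. part_y y0 y1 z \<xi> t) has_real_derivative part_yy y0 y1 z y t) (at y within {y0 t..y1 t})"
    and "(y, t) \<in> open_dom {0<..\<sigma>} y0 y1 \<Longrightarrow>
      ((\<lambda>\<tau>. z y \<tau>) has_real_derivative part_t \<sigma> z y t) (at t within {0..\<sigma>})"
    and "continuous_on (open_dom {0<..\<sigma>} y0 y1) (\<lambda>(y, t). part_yy y0 y1 z y t)"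
    and "continuous_on (open_dom {0<..\<sigma>} y0 y1) (\<lambda>(y, t). part_t \<sigma> z y t)"
proof -
  show "continuous_on {0..\<sigma>} y0" "continuous_on {0..\<sigma>} y1" "t \<in> {0..\<sigma>} \<Longrightarrow> y0 t < y1 t"
    "continuous_on (closed_dom {0..\<sigma>} y0 y1) (\<lambda>(y, t). z y t)"
    "continuous_on (closed_dom {0<..\<sigma>} y0 y1) (\<lambda>(y, t). part_y y0 y1 z y t)"
    "continuous_on (open_dom {0<..\<sigma>} y0 y1) (\<lambda>(y, t). part_yy y0 y1 z y t)"
    "continuous_on (open_dom {0<..\<sigma>} y0 y1) (\<lambda>(y, t). part_t \<sigma> z y t)"
    using assms unfolding classical_def by blast+
  show "((\<lambda>\<xi>. z \<xi> t) has_real_derivative part_y y0 y1 z y t) (at y within {y0 t..y1 t})"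
    if "(y, t) \<in> closed_dom {0<..\<sigma>} y0 y1"
    unfolding part_y_def
    by (rule DERIV_from_differentiable) (use assms that in \<open>auto simp: classical_def\<close>)
  show "((\<lambda>\<xi>. part_y y0 y1 z \<xi> t) has_real_derivative part_yy y0 y1 z y t)
      (at y within {y0 t..y1 t})"
    if "(y, t) \<in> open_dom {0<..\<sigma>} y0 y1"
    unfolding part_yy_def part_y_def[of _ _ "part_y y0 y1 z"]
    by (rule DERIV_from_differentiable) (use assms that in \<open>auto simp: classical_def\<close>)
  show "((\<lambda>\<tau>. z y \<tau>) has_real_derivative part_t \<sigma> z y t) (at t within {0..\<sigma>})"
    if "(y, t) \<in> open_dom {0<..\<sigma>} y0 y1"
    unfolding part_t_def
    by (rule DERIV_from_differentiable) (use assms that in \<open>auto simp: classical_def\<close>)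
qed

lemma classical_boundary_DERIV:
  assumes "classical \<sigma> y0 y1 z" "t \<in> {0<..\<sigma>}"
  obtains c where "(y1 has_real_derivative c) (at t within {0..\<sigma>})"
proof -
  obtain y1' where "\<And>t. t \<in> {0<..\<sigma>} \<Longrightarrow> (y1 has_real_derivative y1' t) (at t within {0<..\<sigma>})"
    using assms unfolding classical_def cont_diff_on_def by blast
  moreover have "at t within {0..\<sigma>} = at t within {0<..\<sigma>}"
    by (rule at_within_nhd[of _ "{0<..}"]) (use assms in auto)
  ultimately show thesis
    using assms(2) that by metis
qed

text \<open>To recognise a classical function it suffices to exhibit its derivatives. The conditions on the
  free boundaries alone are borrowed from another classical function \<open>u\<close> on the same domain.\<close>
lemma classicalI:
  assumes u: "classical \<sigma> y0 y1 u"
    and z: "continuous_on (closed_dom {0..\<sigma>} y0 y1) (\<lambda>(y, t). z y t)"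
    and zy: "\<And>y t. (y, t) \<in> closed_dom {0<..\<sigma>} y0 y1 \<Longrightarrow>
      ((\<lambda>\<xi>. z \<xi> t) has_real_derivative zy y t) (at y within {y0 t..y1 t})"
    and contzy: "continuous_on (closed_dom {0<..\<sigma>} y0 y1) (\<lambda>(y, t). zy y t)"
    and zyy: "\<And>y t. (y, t) \<in> open_dom {0<..\<sigma>} y0 y1 \<Longrightarrow>
      ((\<lambda>\<xi>. zy \<xi> t) has_real_derivative zyy y t) (at y within {y0 t..y1 t})"
    and contzyy: "continuous_on (open_dom {0<..\<sigma>} y0 y1) (\<lambda>(y, t). zyy y t)"
    and zt: "\<And>y t. (y, t) \<in> open_dom {0<..\<sigma>} y0 y1 \<Longrightarrow>
      ((\<lambda>\<tau>. z y \<tau>) has_real_derivative zt y t) (at t within {0..\<sigma>})"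
    and contzt: "continuous_on (open_dom {0<..\<sigma>} y0 y1) (\<lambda>(y, t). zt y t)"
  shows "classical \<sigma> y0 y1 z"
    and "(y, t) \<in> closed_dom {0<..\<sigma>} y0 y1 \<Longrightarrow> part_y y0 y1 z y t = zy y t"
    and "(y, t) \<in> open_dom {0<..\<sigma>} y0 y1 \<Longrightarrow> part_yy y0 y1 z y t = zyy y t"
    and "(y, t) \<in> open_dom {0<..\<sigma>} y0 y1 \<Longrightarrow> part_t \<sigma> z y t = zt y t"
proof -
  note order = classicalD(3)[OF u]
  have part_y: "part_y y0 y1 z y t = zy y t" if "(y, t) \<in> closed_dom {0<..\<sigma>} y0 y1" for y t
    unfolding part_y_def
    by (rule vector_derivative_real_within[OF zy[OF that]])
      (use that order[of t] in \<open>auto simp: closed_dom_def\<close>)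
  have zyy': "((\<lambda>\<xi>. part_y y0 y1 z \<xi> t) has_real_derivative zyy y t) (at y within {y0 t..y1 t})"
    if "(y, t) \<in> open_dom {0<..\<sigma>} y0 y1" for y t
    by (rule has_field_derivative_transform_within[OF zyy[OF that], of 1])
      (use that part_y in \<open>auto simp: closed_dom_def open_dom_def\<close>)
  have part_yy: "part_yy y0 y1 z y t = zyy y t" if "(y, t) \<in> open_dom {0<..\<sigma>} y0 y1" for y t
    unfolding part_yy_def part_y_def[of _ _ "part_y y0 y1 z"]
    by (rule vector_derivative_real_within[OF zyy'[OF that]])
      (use that order[of t] in \<open>auto simp: open_dom_def\<close>)
  have part_t: "part_t \<sigma> z y t = zt y t" if "(y, t) \<in> open_dom {0<..\<sigma>} y0 y1" for y t
    unfolding part_t_def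
    by (rule vector_derivative_real_within[OF zt[OF that]])
      (use that in \<open>auto simp: open_dom_def\<close>)
  show "(y, t) \<in> closed_dom {0<..\<sigma>} y0 y1 \<Longrightarrow> part_y y0 y1 z y t = zy y t"
    "(y, t) \<in> open_dom {0<..\<sigma>} y0 y1 \<Longrightarrow> part_yy y0 y1 z y t = zyy y t"
    "(y, t) \<in> open_dom {0<..\<sigma>} y0 y1 \<Longrightarrow> part_t \<sigma> z y t = zt y t"
    by (fact part_y part_yy part_t)+
  have cy: "continuous_on (closed_dom {0<..\<sigma>} y0 y1) (\<lambda>(y, t). part_y y0 y1 z y t)"
    by (rule continuous_on_eq[OF contzy]) (auto simp: part_y)
  have cyy: "continuous_on (open_dom {0<..\<sigma>} y0 y1) (\<lambda>(y, t). part_yy y0 y1 z y t)"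
    by (rule continuous_on_eq[OF contzyy]) (auto simp: part_yy)
  have ct: "continuous_on (open_dom {0<..\<sigma>} y0 y1) (\<lambda>(y, t). part_t \<sigma> z y t)"
    by (rule continuous_on_eq[OF contzt]) (auto simp: part_t)
  have diff: "h differentiable F" if "(h has_real_derivative d) F" for h :: "real \<Rightarrow> real" and d F
    using that by (auto simp: differentiable_def has_field_derivative_def)
  show "classical \<sigma> y0 y1 z"
    using u z cy cyy ct diff[OF zy] diff[OF zyy'] diff[OF zt]
    unfolding classical_def by auto
qed

text \<open>The product rule for a multiplier \<open>G\<close> that is regular enough. It is used with \<open>G = Z\<close> to pass from
  \<open>V\<close> to \<open>w\<close>, and with \<open>G = 1 / Z\<close> to pass back.\<close>
lemma classical_mult:
  assumes u: "classical \<sigma> y0 y1 u"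
    and w: "\<And>y t. (y, t) \<in> closed_dom {0..\<sigma>} y0 y1 \<Longrightarrow> w y t = G y t * u y t"
    and G: "continuous_on (closed_dom {0..\<sigma>} y0 y1) (\<lambda>(y, t). G y t)"
    and Gy: "\<And>y t. (y, t) \<in> closed_dom {0<..\<sigma>} y0 y1 \<Longrightarrow>
      ((\<lambda>\<xi>. G \<xi> t) has_real_derivative Gy y t) (at y within {y0 t..y1 t})"
    and contGy: "continuous_on (closed_dom {0<..\<sigma>} y0 y1) (\<lambda>(y, t). Gy y t)"
    and Gyy: "\<And>y t. (y, t) \<in> open_dom {0<..\<sigma>} y0 y1 \<Longrightarrow>
      ((\<lambda>\<xi>. Gy \<xi> t) has_real_derivative Gyy y t) (at y within {y0 t..y1 t})"
    and contGyy: "continuous_on (open_dom {0<..\<sigma>} y0 y1) (\<lambda>(y, t). Gyy y t)"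
    and Gt: "\<And>y t. (y, t) \<in> open_dom {0<..\<sigma>} y0 y1 \<Longrightarrow>
      ((\<lambda>\<tau>. G y \<tau>) has_real_derivative Gt y t) (at t within {0..\<sigma>})"
    and contGt: "continuous_on (open_dom {0<..\<sigma>} y0 y1) (\<lambda>(y, t). Gt y t)"
  shows "classical \<sigma> y0 y1 w"
    and "(y, t) \<in> closed_dom {0<..\<sigma>} y0 y1 \<Longrightarrow>
      part_y y0 y1 w y t = Gy y t * u y t + G y t * part_y y0 y1 u y t"
    and "(y, t) \<in> open_dom {0<..\<sigma>} y0 y1 \<Longrightarrow> part_yy y0 y1 w y t =
      Gyy y t * u y t + 2 * Gy y t * part_y y0 y1 u y t + G y t * part_yy y0 y1 u y t"
    and "(y, t) \<in> open_dom {0<..\<sigma>} y0 y1 \<Longrightarrow>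
      part_t \<sigma> w y t = Gt y t * u y t + G y t * part_t \<sigma> u y t"
proof -
  let ?zy = "\<lambda>y t. Gy y t * u y t + G y t * part_y y0 y1 u y t"
  let ?zyy = "\<lambda>y t. Gyy y t * u y t + 2 * Gy y t * part_y y0 y1 u y t + G y t * part_yy y0 y1 u y t"
  let ?zt = "\<lambda>y t. Gt y t * u y t + G y t * part_t \<sigma> u y t"
  note U = classicalD[OF u]
  have pos_sub: "closed_dom {0<..\<sigma>} y0 y1 \<subseteq> closed_dom {0..\<sigma>} y0 y1"
    by (intro closed_dom_mono) auto
  have open_sub: "open_dom {0<..\<sigma>} y0 y1 \<subseteq> closed_dom {0..\<sigma>} y0 y1"
    using open_dom_subset pos_sub by blast
  have 0: "continuous_on (closed_dom {0..\<sigma>} y0 y1) (\<lambda>(y, t). w y t)"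
    by (rule continuous_on_eq[OF continuous_on_mult[OF G U(4)]]) (auto simp: w)
  have 1: "((\<lambda>\<xi>. w \<xi> t) has_real_derivative ?zy y t) (at y within {y0 t..y1 t})"
    if *: "(y, t) \<in> closed_dom {0<..\<sigma>} y0 y1" for y t
  proof -
    have "((\<lambda>\<xi>. G \<xi> t * u \<xi> t) has_real_derivative ?zy y t) (at y within {y0 t..y1 t})"
      by (rule DERIV_cong[OF DERIV_mult[OF Gy[OF *] U(5)[OF *]]]) simp
    then show ?thesis
      by (rule has_field_derivative_transform_within[of _ _ _ _ 1])
        (use * in \<open>auto simp: w closed_dom_def\<close>)
  qed
  have 2: "continuous_on (closed_dom {0<..\<sigma>} y0 y1) (\<lambda>(y, t). ?zy y t)"
    using contGy continuous_on_subset[OF U(4) pos_sub] continuous_on_subset[OF G pos_sub] U(6)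
    unfolding case_prod_beta by (intro continuous_intros)
  have 3: "((\<lambda>\<xi>. ?zy \<xi> t) has_real_derivative ?zyy y t) (at y within {y0 t..y1 t})"
    if *: "(y, t) \<in> open_dom {0<..\<sigma>} y0 y1" for y t
  proof -
    have c: "(y, t) \<in> closed_dom {0<..\<sigma>} y0 y1"
      using * open_dom_subset by blast
    show ?thesis
      by (rule DERIV_cong[OF DERIV_add[OF DERIV_mult[OF Gyy[OF *] U(5)[OF c]]
              DERIV_mult[OF Gy[OF c] U(7)[OF *]]]]) (simp add: algebra_simps)
  qed
  have 4: "continuous_on (open_dom {0<..\<sigma>} y0 y1) (\<lambda>(y, t). ?zyy y t)"
    using continuous_on_subset[OF contGy open_dom_subset] continuous_on_subset[OF U(4) open_sub]
      continuous_on_subset[OF G open_sub] continuous_on_subset[OF U(6) open_dom_subset]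
      U(9) contGyy
    unfolding case_prod_beta by (intro continuous_intros)
  have 5: "((\<lambda>\<tau>. w y \<tau>) has_real_derivative ?zt y t) (at t within {0..\<sigma>})"
    if *: "(y, t) \<in> open_dom {0<..\<sigma>} y0 y1" for y t
  proof -
    obtain d where d: "d > 0" "\<And>\<tau>. \<tau> \<in> {0..\<sigma>} \<Longrightarrow> dist \<tau> t < d \<Longrightarrow> (y, \<tau>) \<in> open_dom {0<..\<sigma>} y0 y1"
      using open_dom_stable_in_time[OF * U(1,2)] by blast
    have "((\<lambda>\<tau>. G y \<tau> * u y \<tau>) has_real_derivative ?zt y t) (at t within {0..\<sigma>})"
      by (rule DERIV_cong[OF DERIV_mult[OF Gt[OF *] U(8)[OF *]]]) simp
    then show ?thesis
    proof (rule has_field_derivative_transform_within[OF _ d(1)])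
      show "t \<in> {0..\<sigma>}" using * by (auto simp: open_dom_def)
      show "G y \<tau> * u y \<tau> = w y \<tau>" if "\<tau> \<in> {0..\<sigma>}" "dist \<tau> t < d" for \<tau>
        using w[OF subsetD[OF open_sub d(2)[OF that]]] by simp
    qed
  qed
  have 6: "continuous_on (open_dom {0<..\<sigma>} y0 y1) (\<lambda>(y, t). ?zt y t)"
    using continuous_on_subset[OF U(4) open_sub] continuous_on_subset[OF G open_sub] U(10) contGt
    unfolding case_prod_beta by (intro continuous_intros)
  show "classical \<sigma> y0 y1 w"
    by (rule classicalI(1)[OF u, of w ?zy ?zyy ?zt]) (fact 0 1 2 3 4 5 6)+
  show "(y, t) \<in> closed_dom {0<..\<sigma>} y0 y1 \<Longrightarrow> part_y y0 y1 w y t = ?zy y t"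
    by (rule classicalI(2)[OF u, of w ?zy ?zyy ?zt]) (assumption | rule 0 1 2 3 4 5 6)+
  show "(y, t) \<in> open_dom {0<..\<sigma>} y0 y1 \<Longrightarrow> part_yy y0 y1 w y t = ?zyy y t"
    by (rule classicalI(3)[OF u, of w ?zy ?zyy ?zt]) (assumption | rule 0 1 2 3 4 5 6)+
  show "(y, t) \<in> open_dom {0<..\<sigma>} y0 y1 \<Longrightarrow> part_t \<sigma> w y t = ?zt y t"
    by (rule classicalI(4)[OF u, of w ?zy ?zyy ?zt]) (assumption | rule 0 1 2 3 4 5 6)+
qed

section \<open>The Hopf-Cole transformation\<close>

text \<open>Here \<open>Z\<^sub>y = - Z V / D\<close> and \<open>Z\<^sub>t = - Z (V\<^sub>y - V\<^sup>2 / D)\<close> are expressed through \<open>V\<close>; the latter is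
  \<open>- w\<^sub>y\<close>, but \<open>w\<close> is not yet known to be differentiable. Substituting both into the product rule, the
  cubic terms cancel.\<close>
lemma hopf_cole_forward:
  assumes D: "D \<noteq> 0" and V: "classical \<sigma> y0 y1 V"
    and w: "\<And>y t. (y, t) \<in> closed_dom {0..\<sigma>} y0 y1 \<Longrightarrow> w y t = Z y t * V y t"
    and Z: "continuous_on (closed_dom {0..\<sigma>} y0 y1) (\<lambda>(y, t). Z y t)"
    and Zy: "\<And>y t. (y, t) \<in> closed_dom {0<..\<sigma>} y0 y1 \<Longrightarrow>
      ((\<lambda>\<xi>. Z \<xi> t) has_real_derivative - (Z y t * V y t / D)) (at y within {y0 t..y1 t})"
    and Zt: "\<And>y t. (y, t) \<in> open_dom {0<..\<sigma>} y0 y1 \<Longrightarrow>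
      ((\<lambda>\<tau>. Z y \<tau>) has_real_derivative - (Z y t * (part_y y0 y1 V y t - (V y t)\<^sup>2 / D)))
        (at t within {0..\<sigma>})"
  shows "classical \<sigma> y0 y1 w"
    and "(y, t) \<in> closed_dom {0<..\<sigma>} y0 y1 \<Longrightarrow>
      part_y y0 y1 w y t = Z y t * (part_y y0 y1 V y t - (V y t)\<^sup>2 / D)"
    and "(y, t) \<in> open_dom {0<..\<sigma>} y0 y1 \<Longrightarrow> part_t \<sigma> w y t - D * part_yy y0 y1 w y t =
      Z y t * (part_t \<sigma> V y t - (D * part_yy y0 y1 V y t - 2 * V y t * part_y y0 y1 V y t))"
proof -
  let ?Vy = "part_y y0 y1 V"
  let ?Zy = "\<lambda>y t. - (Z y t * V y t / D)"
  let ?Zyy = "\<lambda>y t. Z y t * (V y t)\<^sup>2 / D\<^sup>2 - Z y t * ?Vy y t / D"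
  let ?Zt = "\<lambda>y t. - (Z y t * (?Vy y t - (V y t)\<^sup>2 / D))"
  note U = classicalD[OF V]
  have pos_sub: "closed_dom {0<..\<sigma>} y0 y1 \<subseteq> closed_dom {0..\<sigma>} y0 y1"
    by (intro closed_dom_mono) auto
  have open_sub: "open_dom {0<..\<sigma>} y0 y1 \<subseteq> closed_dom {0..\<sigma>} y0 y1"
    using open_dom_subset pos_sub by blast
  have contZy: "continuous_on (closed_dom {0<..\<sigma>} y0 y1) (\<lambda>(y, t). ?Zy y t)"
    using continuous_on_subset[OF U(4) pos_sub] continuous_on_subset[OF Z pos_sub] D
    unfolding case_prod_beta by (intro continuous_intros) auto
  have Zyy: "((\<lambda>\<xi>. ?Zy \<xi> t) has_real_derivative ?Zyy y t) (at y within {y0 t..y1 t})"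
    if *: "(y, t) \<in> open_dom {0<..\<sigma>} y0 y1" for y t
  proof -
    have c: "(y, t) \<in> closed_dom {0<..\<sigma>} y0 y1"
      using * open_dom_subset by blast
    show ?thesis
      by (rule DERIV_cong[OF DERIV_minus[OF DERIV_cdivide[OF DERIV_mult[OF Zy[OF c] U(5)[OF c]]]]])
        (use D in \<open>simp add: field_simps power2_eq_square\<close>)
  qed
  have contZyy: "continuous_on (open_dom {0<..\<sigma>} y0 y1) (\<lambda>(y, t). ?Zyy y t)"
    and contZt: "continuous_on (open_dom {0<..\<sigma>} y0 y1) (\<lambda>(y, t). ?Zt y t)"
    using continuous_on_subset[OF U(4) open_sub] continuous_on_subset[OF Z open_sub]
      continuous_on_subset[OF U(6) open_dom_subset] D
    unfolding case_prod_beta by (intro continuous_intros; simp)+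
  note M = classical_mult[OF V w Z Zy contZy Zyy contZyy Zt contZt]
  show "classical \<sigma> y0 y1 w"
    by (rule M(1))
  show "part_y y0 y1 w y t = Z y t * (?Vy y t - (V y t)\<^sup>2 / D)"
    if "(y, t) \<in> closed_dom {0<..\<sigma>} y0 y1"
  proof -
    have "part_y y0 y1 w y t = ?Zy y t * V y t + Z y t * ?Vy y t"
      using M(2) that by auto
    then show ?thesis
      by (simp add: algebra_simps power2_eq_square)
  qed
  show "part_t \<sigma> w y t - D * part_yy y0 y1 w y t =
      Z y t * (part_t \<sigma> V y t - (D * part_yy y0 y1 V y t - 2 * V y t * ?Vy y t))"
    if "(y, t) \<in> open_dom {0<..\<sigma>} y0 y1"
  proof -
    have eqs: "part_yy y0 y1 w y t = ?Zyy y t * V y t + 2 * ?Zy y t * ?Vy y t + Z y t * part_yy y0 y1 V y t"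
      "part_t \<sigma> w y t = ?Zt y t * V y t + Z y t * part_t \<sigma> V y t"
      using M(3,4) that by auto
    show ?thesis
      using D unfolding eqs by (simp add: field_simps power2_eq_square)
  qed
qed

text \<open>The same computation read from \<open>w\<close> to \<open>V\<close>, with the derivatives of \<open>Z\<close> expressed through \<open>w\<close>.\<close>
lemma hopf_cole_backward:
  assumes D: "D \<noteq> 0" and w: "classical \<sigma> y0 y1 w"
    and V: "\<And>y t. (y, t) \<in> closed_dom {0..\<sigma>} y0 y1 \<Longrightarrow> V y t = w y t / Z y t"
    and pos: "\<And>y t. (y, t) \<in> closed_dom {0..\<sigma>} y0 y1 \<Longrightarrow> Z y t > 0"
    and Z: "continuous_on (closed_dom {0..\<sigma>} y0 y1) (\<lambda>(y, t). Z y t)"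
    and Zy: "\<And>y t. (y, t) \<in> closed_dom {0<..\<sigma>} y0 y1 \<Longrightarrow>
      ((\<lambda>\<xi>. Z \<xi> t) has_real_derivative - (w y t / D)) (at y within {y0 t..y1 t})"
    and Zt: "\<And>y t. (y, t) \<in> open_dom {0<..\<sigma>} y0 y1 \<Longrightarrow>
      ((\<lambda>\<tau>. Z y \<tau>) has_real_derivative - part_y y0 y1 w y t) (at t within {0..\<sigma>})"
  shows "classical \<sigma> y0 y1 V"
    and "(y, t) \<in> closed_dom {0<..\<sigma>} y0 y1 \<Longrightarrow>
      part_y y0 y1 w y t = Z y t * (part_y y0 y1 V y t - (V y t)\<^sup>2 / D)"
    and "(y, t) \<in> open_dom {0<..\<sigma>} y0 y1 \<Longrightarrow> part_t \<sigma> w y t - D * part_yy y0 y1 w y t =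
      Z y t * (part_t \<sigma> V y t - (D * part_yy y0 y1 V y t - 2 * V y t * part_y y0 y1 V y t))"
proof -
  let ?wy = "part_y y0 y1 w"
  let ?G = "\<lambda>y t. inverse (Z y t)"
  let ?Gy = "\<lambda>y t. w y t / (D * (Z y t)\<^sup>2)"
  let ?Gyy = "\<lambda>y t. ?wy y t / (D * (Z y t)\<^sup>2) + 2 * (w y t)\<^sup>2 / (D\<^sup>2 * (Z y t) ^ 3)"
  let ?Gt = "\<lambda>y t. ?wy y t / (Z y t)\<^sup>2"
  note U = classicalD[OF w]
  have pos_sub: "closed_dom {0<..\<sigma>} y0 y1 \<subseteq> closed_dom {0..\<sigma>} y0 y1"
    by (intro closed_dom_mono) auto
  have open_sub: "open_dom {0<..\<sigma>} y0 y1 \<subseteq> closed_dom {0..\<sigma>} y0 y1"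
    using open_dom_subset pos_sub by blast
  have nz: "Z (fst p) (snd p) \<noteq> 0" if "p \<in> closed_dom {0..\<sigma>} y0 y1" for p
    using pos[of "fst p" "snd p"] that by simp
  have V': "\<And>y t. (y, t) \<in> closed_dom {0..\<sigma>} y0 y1 \<Longrightarrow> V y t = ?G y t * w y t"
    using V by (simp add: divide_inverse mult.commute)
  have contG: "continuous_on (closed_dom {0..\<sigma>} y0 y1) (\<lambda>(y, t). ?G y t)"
    using Z nz unfolding case_prod_beta by (intro continuous_intros) auto
  have contGy: "continuous_on (closed_dom {0<..\<sigma>} y0 y1) (\<lambda>(y, t). ?Gy y t)"
    using continuous_on_subset[OF U(4) pos_sub] continuous_on_subset[OF Z pos_sub] D nz pos_sub
    unfolding case_prod_beta by (intro continuous_intros) auto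
  have Gy: "((\<lambda>\<xi>. ?G \<xi> t) has_real_derivative ?Gy y t) (at y within {y0 t..y1 t})"
    if *: "(y, t) \<in> closed_dom {0<..\<sigma>} y0 y1" for y t
    by (rule DERIV_cong[OF DERIV_inverse'[OF Zy[OF *]]])
      (use nz[of "(y, t)"] * pos_sub D in \<open>auto simp: field_simps power2_eq_square\<close>)
  have Gyy: "((\<lambda>\<xi>. ?Gy \<xi> t) has_real_derivative ?Gyy y t) (at y within {y0 t..y1 t})"
    if *: "(y, t) \<in> open_dom {0<..\<sigma>} y0 y1" for y t
  proof -
    have c: "(y, t) \<in> closed_dom {0<..\<sigma>} y0 y1" and z: "Z y t \<noteq> 0"
      using * open_dom_subset open_sub nz[of "(y, t)"] by auto
    show ?thesis
      by (rule DERIV_cong[OF DERIV_divide[OF U(5)[OF c] DERIV_cmult[OF DERIV_power[OF Zy[OF c]]]]])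
        (use D z in \<open>simp_all add: field_simps power2_eq_square power3_eq_cube\<close>)
  qed
  have contGyy: "continuous_on (open_dom {0<..\<sigma>} y0 y1) (\<lambda>(y, t). ?Gyy y t)"
    and contGt: "continuous_on (open_dom {0<..\<sigma>} y0 y1) (\<lambda>(y, t). ?Gt y t)"
    using continuous_on_subset[OF U(4) open_sub] continuous_on_subset[OF Z open_sub]
      continuous_on_subset[OF U(6) open_dom_subset] D nz open_sub
    unfolding case_prod_beta by (intro continuous_intros; auto)+
  have Gt: "((\<lambda>\<tau>. ?G y \<tau>) has_real_derivative ?Gt y t) (at t within {0..\<sigma>})"
    if *: "(y, t) \<in> open_dom {0<..\<sigma>} y0 y1" for y t
    by (rule DERIV_cong[OF DERIV_inverse'[OF Zt[OF *]]])
      (use nz[of "(y, t)"] * open_sub in \<open>auto simp: field_simps power2_eq_square\<close>)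
  note M = classical_mult[OF w V' contG Gy contGy Gyy contGyy Gt contGt]
  show "classical \<sigma> y0 y1 V"
    by (rule M(1))
  have Vy: "part_y y0 y1 V y t = ?Gy y t * w y t + ?G y t * ?wy y t"
    if "(y, t) \<in> closed_dom {0<..\<sigma>} y0 y1" for y t
    using M(2) that by auto
  show "?wy y t = Z y t * (part_y y0 y1 V y t - (V y t)\<^sup>2 / D)"
    if *: "(y, t) \<in> closed_dom {0<..\<sigma>} y0 y1"
  proof -
    have "(y, t) \<in> closed_dom {0..\<sigma>} y0 y1"
      using * pos_sub by blast
    then show ?thesis
      using nz[of "(y, t)"] D by (simp add: Vy[OF *] V field_simps power2_eq_square)
  qed
  show "part_t \<sigma> w y t - D * part_yy y0 y1 w y t =
      Z y t * (part_t \<sigma> V y t - (D * part_yy y0 y1 V y t - 2 * V y t * part_y y0 y1 V y t))"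
    if *: "(y, t) \<in> open_dom {0<..\<sigma>} y0 y1"
  proof -
    have c: "(y, t) \<in> closed_dom {0<..\<sigma>} y0 y1" "(y, t) \<in> closed_dom {0..\<sigma>} y0 y1"
      using * open_dom_subset open_sub by auto
    have "part_yy y0 y1 V y t = ?Gyy y t * w y t + 2 * ?Gy y t * ?wy y t + ?G y t * part_yy y0 y1 w y t"
      "part_t \<sigma> V y t = ?Gt y t * w y t + ?G y t * part_t \<sigma> w y t"
      using M(3,4) that by auto
    then show ?thesis
      using D nz[OF c(2)]
      by (simp add: Vy[OF c(1)] V[OF c(2)] field_simps power2_eq_square power3_eq_cube)
  qed
qed

text \<open>The facts that relate \<open>V\<close> and \<open>w\<close> symmetrically. They hold as soon as one of the two functions
  solves its problem and the other one arises from it by the transformation, and are all that is needed to translate the conditions of the problems into each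
  other.\<close>
locale hopf_cole_pair =
  fixes D \<sigma> :: real and y0 y1 :: "real \<Rightarrow> real" and V w Z :: "real \<Rightarrow> real \<Rightarrow> real"
  assumes classical_V: "classical \<sigma> y0 y1 V" and classical_w: "classical \<sigma> y0 y1 w"
    and Z_pos: "(y, t) \<in> closed_dom {0..\<sigma>} y0 y1 \<Longrightarrow> Z y t > 0"
    and w_eq: "(y, t) \<in> closed_dom {0..\<sigma>} y0 y1 \<Longrightarrow> w y t = Z y t * V y t"
    and w_y_eq: "(y, t) \<in> closed_dom {0<..\<sigma>} y0 y1 \<Longrightarrow>
      part_y y0 y1 w y t = Z y t * (part_y y0 y1 V y t - (V y t)\<^sup>2 / D)"
    and heat_eq: "(y, t) \<in> open_dom {0<..\<sigma>} y0 y1 \<Longrightarrow>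
      part_t \<sigma> w y t - D * part_yy y0 y1 w y t =
      Z y t * (part_t \<sigma> V y t - (D * part_yy y0 y1 V y t - 2 * V y t * part_y y0 y1 V y t))"
    and V_zero: "t \<in> {0<..\<sigma>} \<Longrightarrow> V (y1 t) t = 0"
    and int_V: "(\<lambda>\<tau>. part_y y0 y1 V (y1 \<tau>) \<tau>) integrable_on {0..\<sigma>}"
    and int_w: "(\<lambda>\<tau>. part_y y0 y1 w (y1 \<tau>) \<tau>) integrable_on {0..\<sigma>}"
    and C_exp: "t \<in> {0..\<sigma>} \<Longrightarrow>
      C_fun y0 y1 w t = exp (- integral {0..t} (\<lambda>\<tau>. part_y y0 y1 V (y1 \<tau>) \<tau>))"
    and Z_V: "(y, t) \<in> closed_dom {0..\<sigma>} y0 y1 \<Longrightarrow> Z y t = C_fun y0 y1 w t * eta D y1 V y t"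
    and Z_w: "(y, t) \<in> closed_dom {0..\<sigma>} y0 y1 \<Longrightarrow>
      Z y t = C_fun y0 y1 w t + 1 / D * integral {y..y1 t} (\<lambda>\<xi>. w \<xi> t)"

lemma continuous_on_slice:
  assumes "classical \<sigma> y0 y1 z" "t \<in> {0..\<sigma>}"
  shows "continuous_on {y0 t..y1 t} (\<lambda>\<xi>. z \<xi> t)"
  using assms(2)
  by (intro continuous_on_compose2[OF classicalD(4)[OF assms(1)], of _ "\<lambda>\<xi>. (\<xi>, t)", simplified])
    (auto intro!: continuous_intros simp: closed_dom_def)

lemma continuous_on_boundary_slope:
  assumes "classical \<sigma> y0 y1 z"
  shows "continuous_on {0<..\<sigma>} (\<lambda>t. part_y y0 y1 z (y1 t) t)"
proof -
  have "continuous_on {0<..\<sigma>} y1"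
    by (rule continuous_on_subset[OF classicalD(2)[OF assms]]) auto
  then show ?thesis
    using classicalD(3)[OF assms]
    by (intro continuous_on_compose2[OF classicalD(6)[OF assms], of _ "\<lambda>t. (y1 t, t)", simplified])
      (auto intro!: continuous_intros simp: closed_dom_def less_imp_le)
qed

lemma continuous_on_snd_closed_dom:
  assumes "continuous_on I h"
  shows "continuous_on (closed_dom I y0 y1) (\<lambda>(y, t). h t)"
  unfolding case_prod_beta
  by (rule continuous_on_compose2[OF assms continuous_on_snd[OF continuous_on_id]])
    (auto simp: closed_dom_def)

text \<open>Writing the factor \<open>C\<close> as an exponential of the slope of \<open>V\<close> removes the implicit dependence on
  \<open>w\<close>: the formula for \<open>w\<close> becomes explicit, and \<open>C_fun\<close> of that \<open>w\<close> is computed afterwards.\<close>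
lemma hopf_cole_pair_from_V:
  assumes D: "D > 0" and V: "classical \<sigma> y0 y1 V"
    and pde: "\<And>y t. (y, t) \<in> open_dom {0<..\<sigma>} y0 y1 \<Longrightarrow>
      part_t \<sigma> V y t = D * part_yy y0 y1 V y t - 2 * V y t * part_y y0 y1 V y t"
    and zero: "\<And>t. t \<in> {0<..\<sigma>} \<Longrightarrow> V (y1 t) t = 0"
    and int: "(\<lambda>\<tau>. part_y y0 y1 V (y1 \<tau>) \<tau>) integrable_on {0..\<sigma>}"
    and w: "\<And>y t. (y, t) \<in> closed_dom {0..\<sigma>} y0 y1 \<Longrightarrow>
      w y t = exp (- integral {0..t} (\<lambda>\<tau>. part_y y0 y1 V (y1 \<tau>) \<tau>)) * V y t * eta D y1 V y t"
  shows "hopf_cole_pair D \<sigma> y0 y1 V w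
    (\<lambda>y t. exp (- integral {0..t} (\<lambda>\<tau>. part_y y0 y1 V (y1 \<tau>) \<tau>)) * eta D y1 V y t)"
proof -
  let ?Vy = "part_y y0 y1 V"
  let ?p = "\<lambda>\<tau>. ?Vy (y1 \<tau>) \<tau>"
  define K where "K t = exp (- integral {0..t} ?p)" for t
  define Z where "Z y t = K t * eta D y1 V y t" for y t
  note U = classicalD[OF V]
  have pos_sub: "closed_dom {0<..\<sigma>} y0 y1 \<subseteq> closed_dom {0..\<sigma>} y0 y1"
    by (intro closed_dom_mono) auto
  have w': "w y t = Z y t * V y t" if "(y, t) \<in> closed_dom {0..\<sigma>} y0 y1" for y t
    using w[OF that] by (simp add: Z_def K_def)
  have contK: "continuous_on {0..\<sigma>} K"
    unfolding K_def by (intro continuous_intros indefinite_integral_continuous_1 int)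
  have K: "(K has_real_derivative - (K t * ?p t)) (at t within {0..\<sigma>})" if "t \<in> {0<..\<sigma>}" for t
    unfolding K_def
    by (auto intro!: derivative_eq_intros that
        has_derivative_integral_from_singular_endpoint[OF continuous_on_boundary_slope[OF V] int])
  have contZ: "continuous_on (closed_dom {0..\<sigma>} y0 y1) (\<lambda>(y, t). Z y t)"
    using continuous_on_snd_closed_dom[OF contK, of y0 y1]
      continuous_on_tail_integral[OF U(4) U(2)]
    unfolding case_prod_beta Z_def eta_def by (intro continuous_intros)
  have Zy: "((\<lambda>\<xi>. Z \<xi> t) has_real_derivative - (Z y t * V y t / D)) (at y within {y0 t..y1 t})"
    if "(y, t) \<in> closed_dom {0<..\<sigma>} y0 y1" for y t
  proof -
    have t: "t \<in> {0..\<sigma>}" "y \<in> {y0 t..y1 t}" using that by (auto simp: closed_dom_def)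
    show ?thesis
      unfolding Z_def eta_def
      by (rule DERIV_cong[OF DERIV_cmult[OF exp_tail_integral(1)[OF _ continuous_on_slice[OF V t(1)] t(2)]]])
        (use D in auto)
  qed
  have Zt: "((\<lambda>\<tau>. Z y \<tau>) has_real_derivative - (Z y t * (?Vy y t - (V y t)\<^sup>2 / D)))
      (at t within {0..\<sigma>})" if *: "(y, t) \<in> open_dom {0<..\<sigma>} y0 y1" for y t
  proof -
    have t: "t \<in> {0<..\<sigma>}" "y0 t < y" "y < y1 t" using * by (auto simp: open_dom_def)
    obtain c where c: "(y1 has_real_derivative c) (at t within {0..\<sigma>})"
      using classical_boundary_DERIV[OF V t(1)] .
    have "((\<lambda>s. integral {y..y1 s} (\<lambda>\<xi>. V \<xi> s)) has_real_derivative
        (D * ?Vy (y1 t) t - (V (y1 t) t)\<^sup>2) - (D * ?Vy y t - (V y t)\<^sup>2)) (at t within {0..\<sigma>})"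
    proof (rule has_derivative_integral_moving_endpoint[OF t U(1) c, where
          \<Phi> = "\<lambda>y t. D * ?Vy y t - (V y t)\<^sup>2" and zt = "part_t \<sigma> V"])
      show "continuous_on (closed_dom {0<..\<sigma>} y0 y1) (\<lambda>(y, t). D * ?Vy y t - (V y t)\<^sup>2)"
        using continuous_on_subset[OF U(4) pos_sub] U(6)
        unfolding case_prod_beta by (intro continuous_intros)
      fix x s assume xs: "(x, s) \<in> open_dom {0<..\<sigma>} y0 y1"
      then have xs': "(x, s) \<in> closed_dom {0<..\<sigma>} y0 y1" using open_dom_subset by blast
      show "((\<lambda>\<xi>. D * ?Vy \<xi> s - (V \<xi> s)\<^sup>2) has_real_derivative part_t \<sigma> V x s)
          (at x within {y0 s..y1 s})"
        by (rule DERIV_cong[OF DERIV_diff[OF DERIV_cmult[OF U(7)[OF xs]] DERIV_power[OF U(5)[OF xs']]]])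
          (simp add: pde[OF xs])
    qed (use U pos_sub zero t in \<open>auto intro: continuous_on_subset\<close>)
    then have "((\<lambda>s. eta D y1 V y s) has_real_derivative
        eta D y1 V y t * (?p t - ?Vy y t + (V y t)\<^sup>2 / D)) (at t within {0..\<sigma>})"
      unfolding eta_def using D zero[OF t(1)]
      by (auto intro!: derivative_eq_intros simp: field_simps)
    from DERIV_mult[OF K[OF t(1)] this] show ?thesis
      unfolding Z_def by (rule DERIV_cong) (simp add: algebra_simps)
  qed
  note H = hopf_cole_forward[OF _ V w' contZ Zy Zt]
  have wy: "part_y y0 y1 w y t = Z y t * (?Vy y t - (V y t)\<^sup>2 / D)"
    if "(y, t) \<in> closed_dom {0<..\<sigma>} y0 y1" for y t
    using H(2) D that by auto
  have slope: "part_y y0 y1 w (y1 t) t = K t * ?p t" if "t \<in> {0<..\<sigma>}" for t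
  proof -
    have "(y1 t, t) \<in> closed_dom {0<..\<sigma>} y0 y1"
      using U(3)[of t] that by (auto simp: closed_dom_def)
    then show ?thesis
      using wy zero[OF that] by (simp add: Z_def eta_def)
  qed
  have int_wy: "((\<lambda>\<tau>. part_y y0 y1 w (y1 \<tau>) \<tau>) has_integral 1 - K t) {0..t}"
    if t: "t \<in> {0..\<sigma>}" for t
  proof -
    have "((\<lambda>\<tau>. K \<tau> * ?p \<tau>) has_integral - (K t - K 0)) {0..t}"
      using has_integral_neg[OF has_integral_derivative_singular_endpoint[OF contK K t]] by simp
    then have "((\<lambda>\<tau>. part_y y0 y1 w (y1 \<tau>) \<tau>) has_integral - (K t - K 0)) {0..t}"
      by (rule has_integral_spike[of "{0}", rotated 2]) (use slope t in auto)
    then show ?thesis by (simp add: K_def)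
  qed
  have C: "C_fun y0 y1 w t = K t" if "t \<in> {0..\<sigma>}" for t
    using int_wy[OF that] by (simp add: C_fun_def integral_unique)
  show ?thesis
    unfolding K_def[symmetric] Z_def[symmetric]
  proof
    show "classical \<sigma> y0 y1 w"
      using H(1) D by simp
    show "(\<lambda>\<tau>. part_y y0 y1 w (y1 \<tau>) \<tau>) integrable_on {0..\<sigma>}"
    proof (cases "0 \<le> \<sigma>")
      case True
      then show ?thesis using int_wy[of \<sigma>] by auto
    qed (simp add: integrable_on_empty)
    fix y t
    show "part_t \<sigma> w y t - D * part_yy y0 y1 w y t =
        Z y t * (part_t \<sigma> V y t - (D * part_yy y0 y1 V y t - 2 * V y t * ?Vy y t))"
      if "(y, t) \<in> open_dom {0<..\<sigma>} y0 y1"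
      using H(3) D that by auto
    assume dom: "(y, t) \<in> closed_dom {0..\<sigma>} y0 y1"
    then have t: "t \<in> {0..\<sigma>}" "y \<in> {y0 t..y1 t}" by (auto simp: closed_dom_def)
    show "Z y t > 0" by (simp add: Z_def K_def eta_def)
    show "Z y t = C_fun y0 y1 w t * eta D y1 V y t" by (simp add: Z_def C[OF t(1)])
    have "integral {y..y1 t} (\<lambda>\<xi>. w \<xi> t) =
        integral {y..y1 t} (\<lambda>\<xi>. K t * (V \<xi> t * eta D y1 V \<xi> t))"
      by (rule integral_cong) (use t in \<open>auto simp: w' Z_def closed_dom_def\<close>)
    then show "Z y t = C_fun y0 y1 w t + 1 / D * integral {y..y1 t} (\<lambda>\<xi>. w \<xi> t)"
      using exp_tail_integral(2)[OF _ continuous_on_slice[OF V t(1)] t(2), of D] D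
      by (simp add: Z_def C[OF t(1)] eta_def algebra_simps)
  qed (use V w' wy zero int C K_def in auto)
qed

text \<open>In this direction the factor \<open>C\<close> is known, and the positivity of \<open>Z\<close> is the only condition for
  dividing by it. The integral of the slope of \<open>V\<close> comes out as \<open>- ln C\<close>.\<close>
lemma hopf_cole_pair_from_w:
  assumes D: "D > 0" and w: "classical \<sigma> y0 y1 w"
    and pde: "\<And>y t. (y, t) \<in> open_dom {0<..\<sigma>} y0 y1 \<Longrightarrow>
      part_t \<sigma> w y t = D * part_yy y0 y1 w y t"
    and zero: "\<And>t. t \<in> {0<..\<sigma>} \<Longrightarrow> w (y1 t) t = 0"
    and int: "(\<lambda>\<tau>. part_y y0 y1 w (y1 \<tau>) \<tau>) integrable_on {0..\<sigma>}"
    and C_pos: "\<And>t. t \<in> {0..\<sigma>} \<Longrightarrow> C_fun y0 y1 w t > 0"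
    and Z: "\<And>y t. (y, t) \<in> closed_dom {0..\<sigma>} y0 y1 \<Longrightarrow>
      Z y t = C_fun y0 y1 w t + 1 / D * integral {y..y1 t} (\<lambda>\<xi>. w \<xi> t)"
    and pos: "\<And>y t. (y, t) \<in> closed_dom {0..\<sigma>} y0 y1 \<Longrightarrow> Z y t > 0"
    and V: "\<And>y t. (y, t) \<in> closed_dom {0..\<sigma>} y0 y1 \<Longrightarrow> V y t = w y t / Z y t"
  shows "hopf_cole_pair D \<sigma> y0 y1 V w Z"
proof -
  let ?wy = "part_y y0 y1 w"
  let ?q = "\<lambda>\<tau>. ?wy (y1 \<tau>) \<tau>"
  let ?C = "C_fun y0 y1 w"
  let ?Z = "\<lambda>y t. ?C t + 1 / D * integral {y..y1 t} (\<lambda>\<xi>. w \<xi> t)"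
  note U = classicalD[OF w]
  have pos_sub: "closed_dom {0<..\<sigma>} y0 y1 \<subseteq> closed_dom {0..\<sigma>} y0 y1"
    by (intro closed_dom_mono) auto
  have open_sub: "open_dom {0<..\<sigma>} y0 y1 \<subseteq> closed_dom {0..\<sigma>} y0 y1"
    using open_dom_subset pos_sub by blast
  have contC: "continuous_on {0..\<sigma>} ?C"
    unfolding C_fun_def by (intro continuous_intros indefinite_integral_continuous_1 int)
  have C: "(?C has_real_derivative - ?q t) (at t within {0..\<sigma>})" if "t \<in> {0<..\<sigma>}" for t
    unfolding C_fun_def
    by (auto intro!: derivative_eq_intros that
        has_derivative_integral_from_singular_endpoint[OF continuous_on_boundary_slope[OF w] int])
  have "continuous_on (closed_dom {0..\<sigma>} y0 y1) (\<lambda>(y, t). ?Z y t)"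
    using continuous_on_snd_closed_dom[OF contC, of y0 y1]
      continuous_on_tail_integral[OF U(4) U(2)] D
    unfolding case_prod_beta by (intro continuous_intros) auto
  then have contZ: "continuous_on (closed_dom {0..\<sigma>} y0 y1) (\<lambda>(y, t). Z y t)"
    by (rule continuous_on_eq) (auto simp: Z)
  have Zy: "((\<lambda>\<xi>. Z \<xi> t) has_real_derivative - (w y t / D)) (at y within {y0 t..y1 t})"
    if *: "(y, t) \<in> closed_dom {0<..\<sigma>} y0 y1" for y t
  proof -
    have t: "t \<in> {0..\<sigma>}" "y \<in> {y0 t..y1 t}" using * by (auto simp: closed_dom_def)
    have "((\<lambda>\<xi>. ?Z \<xi> t) has_real_derivative - (w y t / D)) (at y within {y0 t..y1 t})"
      by (rule affine_tail_integral(1)[OF _ C_pos[OF t(1)] continuous_on_slice[OF w t(1)] t(2)])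
        (use D in auto)
    then show ?thesis
      by (rule has_field_derivative_transform_within[of _ _ _ _ 1])
        (use t in \<open>auto simp: Z closed_dom_def\<close>)
  qed
  have Zt: "((\<lambda>\<tau>. Z y \<tau>) has_real_derivative - ?wy y t) (at t within {0..\<sigma>})"
    if *: "(y, t) \<in> open_dom {0<..\<sigma>} y0 y1" for y t
  proof -
    have t: "t \<in> {0<..\<sigma>}" "y0 t < y" "y < y1 t" using * by (auto simp: open_dom_def)
    obtain c where c: "(y1 has_real_derivative c) (at t within {0..\<sigma>})"
      using classical_boundary_DERIV[OF w t(1)] .
    obtain d where d: "d > 0" "\<And>\<tau>. \<tau> \<in> {0..\<sigma>} \<Longrightarrow> dist \<tau> t < d \<Longrightarrow> (y, \<tau>) \<in> open_dom {0<..\<sigma>} y0 y1"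
      using open_dom_stable_in_time[OF * U(1,2)] by blast
    have "((\<lambda>s. integral {y..y1 s} (\<lambda>\<xi>. w \<xi> s)) has_real_derivative
        D * ?wy (y1 t) t - D * ?wy y t) (at t within {0..\<sigma>})"
    proof (rule has_derivative_integral_moving_endpoint[OF t U(1) c, where
          \<Phi> = "\<lambda>y t. D * ?wy y t" and zt = "part_t \<sigma> w"])
      show "continuous_on (closed_dom {0<..\<sigma>} y0 y1) (\<lambda>(y, t). D * ?wy y t)"
        using U(6) unfolding case_prod_beta by (intro continuous_intros)
      fix x s assume xs: "(x, s) \<in> open_dom {0<..\<sigma>} y0 y1"
      show "((\<lambda>\<xi>. D * ?wy \<xi> s) has_real_derivative part_t \<sigma> w x s) (at x within {y0 s..y1 s})"
        by (rule DERIV_cong[OF DERIV_cmult[OF U(7)[OF xs]]]) (simp add: pde[OF xs])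
    qed (use U pos_sub zero t in \<open>auto intro: continuous_on_subset\<close>)
    then have "((\<lambda>\<tau>. ?Z y \<tau>) has_real_derivative - ?wy y t) (at t within {0..\<sigma>})"
      using D by (auto intro!: derivative_eq_intros C t simp: field_simps)
    then show ?thesis
    proof (rule has_field_derivative_transform_within[OF _ d(1)])
      show "t \<in> {0..\<sigma>}" using t by auto
      show "?Z y \<tau> = Z y \<tau>" if "\<tau> \<in> {0..\<sigma>}" "dist \<tau> t < d" for \<tau>
        using Z[OF subsetD[OF open_sub d(2)[OF that]]] by simp
    qed
  qed
  note H = hopf_cole_backward[OF _ w V pos contZ Zy Zt]
  have wy: "?wy y t = Z y t * (part_y y0 y1 V y t - (V y t)\<^sup>2 / D)"
    if "(y, t) \<in> closed_dom {0<..\<sigma>} y0 y1" for y t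
    using H(2) D that by auto
  have V_zero: "V (y1 t) t = 0" and slope: "part_y y0 y1 V (y1 t) t = ?q t / ?C t"
    if t: "t \<in> {0<..\<sigma>}" for t
  proof -
    have *: "(y1 t, t) \<in> closed_dom {0<..\<sigma>} y0 y1"
      using U(3)[of t] t by (auto simp: closed_dom_def)
    then have **: "(y1 t, t) \<in> closed_dom {0..\<sigma>} y0 y1"
      using pos_sub by blast
    then show "V (y1 t) t = 0"
      using V zero[OF t] by simp
    then show "part_y y0 y1 V (y1 t) t = ?q t / ?C t"
      using wy[OF *] Z[OF **] C_pos[of t] t by simp
  qed
  have int_Vy: "((\<lambda>\<tau>. part_y y0 y1 V (y1 \<tau>) \<tau>) has_integral - ln (?C t)) {0..t}"
    if t: "t \<in> {0..\<sigma>}" for t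
  proof -
    have cont: "continuous_on {0..\<sigma>} (\<lambda>t. - ln (?C t))"
      using C_pos by (intro continuous_intros contC) (auto simp: less_imp_neq[symmetric])
    have der: "((\<lambda>t. - ln (?C t)) has_real_derivative ?q t / ?C t) (at t within {0..\<sigma>})"
      if "t \<in> {0<..\<sigma>}" for t
      using C_pos[of t] that by (auto intro!: derivative_eq_intros C simp: field_simps)
    have "((\<lambda>\<tau>. part_y y0 y1 V (y1 \<tau>) \<tau>) has_integral - ln (?C t) - - ln (?C 0)) {0..t}"
      by (rule has_integral_spike[of "{0}", OF _ _ has_integral_derivative_singular_endpoint[OF cont der t]])
        (use slope t in auto)
    then show ?thesis by (simp add: C_fun_def)
  qed
  show ?thesis
  proof
    show "classical \<sigma> y0 y1 V"
      using H(1) D by simp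
    show "(\<lambda>\<tau>. part_y y0 y1 V (y1 \<tau>) \<tau>) integrable_on {0..\<sigma>}"
    proof (cases "0 \<le> \<sigma>")
      case True
      then show ?thesis using int_Vy[of \<sigma>] by auto
    qed (simp add: integrable_on_empty)
    show "?C t = exp (- integral {0..t} (\<lambda>\<tau>. part_y y0 y1 V (y1 \<tau>) \<tau>))" if "t \<in> {0..\<sigma>}" for t
      using int_Vy[OF that] C_pos[OF that] by (simp add: integral_unique)
    fix y t
    show "part_t \<sigma> w y t - D * part_yy y0 y1 w y t =
        Z y t * (part_t \<sigma> V y t - (D * part_yy y0 y1 V y t - 2 * V y t * part_y y0 y1 V y t))"
      if "(y, t) \<in> open_dom {0<..\<sigma>} y0 y1"
      using H(3) D that by auto
    assume dom: "(y, t) \<in> closed_dom {0..\<sigma>} y0 y1"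
    then have t: "t \<in> {0..\<sigma>}" "y \<in> {y0 t..y1 t}" by (auto simp: closed_dom_def)
    show "w y t = Z y t * V y t"
      using V[OF dom] pos[OF dom] by simp
    have "integral {y..y1 t} (\<lambda>\<xi>. V \<xi> t) = integral {y..y1 t} (\<lambda>\<xi>. w \<xi> t / ?Z \<xi> t)"
      by (rule integral_cong) (use t in \<open>auto simp: V Z closed_dom_def\<close>)
    moreover have "?Z \<xi> t > 0" if "\<xi> \<in> {y0 t..y1 t}" for \<xi>
      using pos[of \<xi> t] Z[of \<xi> t] that t by (auto simp: closed_dom_def)
    ultimately have "eta D y1 V y t = ?Z y t / ?C t"
      using affine_tail_integral(2)[OF _ C_pos[OF t(1)] continuous_on_slice[OF w t(1)] t(2), of D] D
      unfolding eta_def by simp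
    then show "Z y t = ?C t * eta D y1 V y t"
      using Z[OF dom] C_pos[OF t(1)] by simp
  qed (use w wy V_zero int Z pos in auto)
qed

section \<open>Minimum principle for the heat equation\<close>

text \<open>If \<open>w\<close> is negative somewhere, so is the minimum of \<open>w + \<epsilon> t\<close> for small \<open>\<epsilon> > 0\<close>, and it is
  attained at an interior point with positive time, possibly the final time \<open>T\<close>. There \<open>w\<^sub>y\<^sub>y \<ge> 0\<close>, but
  comparison with earlier times gives \<open>w\<^sub>t \<le> - \<epsilon>\<close>.\<close>
lemma heat_minimum_principle:
  assumes w: "classical \<sigma> y0 y1 w" and D: "D \<ge> 0"
    and heat: "\<And>y t. (y, t) \<in> open_dom {0<..\<sigma>} y0 y1 \<Longrightarrow> part_t \<sigma> w y t = D * part_yy y0 y1 w y t"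
    and T: "T \<le> \<sigma>"
    and left: "\<And>t. t \<in> {0..T} \<Longrightarrow> w (y0 t) t \<ge> 0"
    and right: "\<And>t. t \<in> {0..T} \<Longrightarrow> w (y1 t) t \<ge> 0"
    and init: "\<And>y. y \<in> {y0 0..y1 0} \<Longrightarrow> w y 0 \<ge> 0"
    and yt: "(y, t) \<in> closed_dom {0..T} y0 y1"
  shows "w y t \<ge> 0"
proof (rule ccontr)
  assume neg: "\<not> w y t \<ge> 0"
  note U = classicalD[OF w]
  have t: "0 \<le> t" "t \<le> T" using yt by (auto simp: closed_dom_def)
  have sub: "{0..T} \<subseteq> {0..\<sigma>}" using T by auto
  \<comment> \<open>Then \<open>\<epsilon> t \<le> - w y t / 2\<close>, so the perturbed function is still negative at \<open>(y, t)\<close>; the summand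
    \<open>1\<close> covers \<open>T = 0\<close>.\<close>
  define \<epsilon> where "\<epsilon> = - w y t / (2 * (T + 1))"
  have \<epsilon>: "\<epsilon> > 0" using neg t by (simp add: \<epsilon>_def field_simps)
  define \<phi> where "\<phi> p = w (fst p) (snd p) + \<epsilon> * snd p" for p
  have "compact (closed_dom {0..T} y0 y1)"
    using U(1,2,3) sub by (intro compact_closed_dom) (auto intro: continuous_on_subset less_imp_le)
  moreover have "continuous_on (closed_dom {0..T} y0 y1) \<phi>"
    using continuous_on_subset[OF U(4) closed_dom_mono[OF sub]]
    unfolding \<phi>_def case_prod_beta by (intro continuous_intros)
  ultimately obtain p where p: "p \<in> closed_dom {0..T} y0 y1"
    and pmin: "\<And>q. q \<in> closed_dom {0..T} y0 y1 \<Longrightarrow> \<phi> p \<le> \<phi> q"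
    using yt continuous_attains_inf[of "closed_dom {0..T} y0 y1" \<phi>] by blast
  obtain x s where xs: "p = (x, s)" by (cases p)
  have s: "0 \<le> s" "s \<le> T" "y0 s \<le> x" "x \<le> y1 s" using p by (auto simp: xs closed_dom_def)
  have "\<phi> p < 0"
  proof -
    have "\<epsilon> * t \<le> \<epsilon> * (T + 1)" using t \<epsilon> by (intro mult_left_mono) auto
    also have "\<epsilon> * (T + 1) = - w y t / 2"
    proof -
      have "T + 1 \<noteq> 0" using t by simp
      then show ?thesis unfolding \<epsilon>_def by (simp add: divide_simps)
    qed
    finally have "\<phi> (y, t) < 0" using neg by (simp add: \<phi>_def)
    then show ?thesis using pmin[OF yt] by simp
  qed
  moreover have "\<epsilon> * s \<ge> 0" using \<epsilon> s by simp
  ultimately have wneg: "w x s < 0" by (simp add: \<phi>_def xs)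
  have s0: "s > 0"
    using init[of x] s wneg by (cases "s = 0") auto
  have x: "y0 s < x" "x < y1 s"
    using left[of s] right[of s] s wneg by (cases "x = y0 s"; cases "x = y1 s"; auto)+
  have o: "(x, s) \<in> open_dom {0<..\<sigma>} y0 y1" and c: "(x, s) \<in> closed_dom {0<..\<sigma>} y0 y1"
    using s0 s x T by (auto simp: open_dom_def closed_dom_def)
  have xin: "at x within {y0 s..y1 s} = at x" if "x \<in> {y0 s<..<y1 s}" for x
    using that by (intro at_within_interior) auto
  have wmin: "w x s \<le> w \<xi> s" if "\<xi> \<in> {y0 s..y1 s}" for \<xi>
    using pmin[of "(\<xi>, s)"] that s by (simp add: xs \<phi>_def closed_dom_def)
  have wy: "((\<lambda>\<xi>. w \<xi> s) has_real_derivative part_y y0 y1 w \<xi> s) (at \<xi>)"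
    if "\<xi> \<in> {y0 s<..<y1 s}" for \<xi>
    using U(5)[of \<xi> s] xin[OF that] that s0 s T by (auto simp: closed_dom_def)
  have wy0: "part_y y0 y1 w x s = 0"
  proof (rule DERIV_local_min[OF wy])
    show "\<forall>\<xi>. \<bar>x - \<xi>\<bar> < min (x - y0 s) (y1 s - x) \<longrightarrow> w x s \<le> w \<xi> s"
      using wmin by (auto simp: abs_less_iff)
  qed (use x in auto)
  have wyy: "part_yy y0 y1 w x s \<ge> 0"
  proof (rule ccontr)
    assume "\<not> part_yy y0 y1 w x s \<ge> 0"
    then have "part_yy y0 y1 w x s < 0" by simp
    moreover have "((\<lambda>\<xi>. part_y y0 y1 w \<xi> s) has_real_derivative part_yy y0 y1 w x s) (at x)"
      using U(7)[OF o] xin[of x] x by simp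
    ultimately have "\<exists>d>0. \<forall>h>0. h < d \<longrightarrow> part_y y0 y1 w x s > part_y y0 y1 w (x + h) s"
      by (intro DERIV_neg_dec_right)
    then obtain d where d: "d > 0" "\<And>h. 0 < h \<Longrightarrow> h < d \<Longrightarrow> part_y y0 y1 w (x + h) s < 0"
      using wy0 by metis
    define h where "h = min d (y1 s - x) / 2"
    have h: "0 < h" "h < d" "x + h < y1 s" using d x by (auto simp: h_def min_def field_simps)
    obtain \<xi> where \<xi>: "\<xi> \<in> {x<..<x + h}"
      "w (x + h) s - w x s = (x + h - x) * part_y y0 y1 w \<xi> s"
      using MVT2[of x "x + h" "\<lambda>\<xi>. w \<xi> s" "\<lambda>\<xi>. part_y y0 y1 w \<xi> s"] wy x h by auto
    moreover have "part_y y0 y1 w \<xi> s < 0"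
      using d(2)[of "\<xi> - x"] \<xi> h by auto
    ultimately have "w (x + h) s < w x s"
      using h mult_pos_neg[of h "part_y y0 y1 w \<xi> s"] by simp
    then show False using wmin[of "x + h"] h x by simp
  qed
  have "part_t \<sigma> w x s \<le> - \<epsilon>"
  proof (rule ccontr)
    assume "\<not> part_t \<sigma> w x s \<le> - \<epsilon>"
    then have "part_t \<sigma> w x s + \<epsilon> > 0" by simp
    moreover have "((\<lambda>\<tau>. w x \<tau> + \<epsilon> * \<tau>) has_real_derivative part_t \<sigma> w x s + \<epsilon>) (at s within {0..\<sigma>})"
      by (auto intro!: derivative_eq_intros U(8)[OF o])
    ultimately have "\<exists>d>0. \<forall>h>0. s - h \<in> {0..\<sigma>} \<longrightarrow> h < d \<longrightarrow>
        w x s + \<epsilon> * s > w x (s - h) + \<epsilon> * (s - h)"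
      by (intro has_real_derivative_pos_inc_left)
    then obtain d where d: "d > 0"
      "\<And>h. 0 < h \<Longrightarrow> s - h \<in> {0..\<sigma>} \<Longrightarrow> h < d \<Longrightarrow> w x (s - h) + \<epsilon> * (s - h) < w x s + \<epsilon> * s"
      by metis
    obtain e where e: "e > 0" "\<And>\<tau>. \<tau> \<in> {0..\<sigma>} \<Longrightarrow> dist \<tau> s < e \<Longrightarrow> (x, \<tau>) \<in> open_dom {0<..\<sigma>} y0 y1"
      using open_dom_stable_in_time[OF o U(1,2)] by blast
    define h where "h = min d (min e s) / 2"
    have h: "0 < h" "h < d" "h < e" "h < s" using d e s0 by (auto simp: h_def min_def)
    have \<tau>: "s - h \<in> {0..\<sigma>}" using h s T by auto
    have "dist (s - h) s < e" using h by (simp add: dist_real_def)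
    then have "(x, s - h) \<in> closed_dom {0..T} y0 y1"
      using e(2)[OF \<tau>] s h by (auto simp: open_dom_def closed_dom_def)
    from pmin[OF this] d(2)[OF h(1) \<tau> h(2)] show False
      by (simp add: \<phi>_def xs)
  qed
  moreover have "part_t \<sigma> w x s \<ge> 0"
    using heat[OF o] wyy D by simp
  ultimately show False using \<epsilon> by simp
qed

section \<open>Initial data\<close>

text \<open>Since \<open>u0\<close> is positive, \<open>g\<close> is an increasing homeomorphism onto \<open>[C1, C2]\<close>; so \<open>V0\<close> inherits
  continuity and sign from \<open>u0 - \<beta>\<close>, and the left end \<open>C1\<close> corresponds to \<open>x = 0\<close>.\<close>
lemma initial_profile:
  assumes b: "b > 0" and \<beta>: "\<beta> > 0" and diff: "cont_diff_on {0..b} u0"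
    and end_value: "u0 b = \<beta>" and above: "\<And>x. 0 \<le> x \<Longrightarrow> x < b \<Longrightarrow> u0 x > \<beta>"
  shows "continuous_on {C1..C2 u0 b C1} (V0 \<beta> u0 b C1)"
    and "y \<in> {C1..C2 u0 b C1} \<Longrightarrow> V0 \<beta> u0 b C1 y \<ge> 0"
    and "V0 \<beta> u0 b C1 C1 > 0"
proof -
  let ?g = "g u0 C1"
  have contu: "continuous_on {0..b} u0"
    using diff unfolding cont_diff_on_def
    by (meson DERIV_continuous continuous_on_eq_continuous_within)
  have pos: "u0 x \<ge> \<beta>" "u0 x > 0" if "x \<in> {0..b}" for x
    using above[of x] end_value \<beta> that by (cases "x = b"; force)+
  have cont1: "continuous_on {0..b} (\<lambda>\<xi>. 1 / u0 \<xi>)"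
    using pos by (intro continuous_intros contu) (auto simp: less_imp_neq[symmetric])
  have contg: "continuous_on {0..b} ?g"
    unfolding g_def[abs_def]
    by (intro continuous_intros indefinite_integral_continuous_1 integrable_continuous_real cont1)
  have der: "(?g has_real_derivative 1 / u0 x) (at x within {0..b})" if "x \<in> {0..b}" for x
    unfolding g_def[abs_def]
    by (auto intro!: derivative_eq_intros integral_has_real_derivative[OF cont1] that)
  have mono: "?g x < ?g y" if "0 \<le> x" "x < y" "y \<le> b" for x y
  proof (rule DERIV_pos_imp_increasing_open[OF that(2)])
    show "continuous_on {x..y} ?g"
      using contg that by (auto intro: continuous_on_subset)
    fix z assume z: "x < z" "z < y"
    then have "at z within {0..b} = at z"
      using that by (intro at_within_interior) auto
    then show "\<exists>d. (?g has_real_derivative d) (at z) \<and> d > 0"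
      using der[of z] pos[of z] z that by (intro exI[of _ "1 / u0 z"]) auto
  qed
  have inj: "inj_on ?g {0..b}"
    by (rule linorder_inj_onI) (use mono in \<open>force+\<close>)
  have surj: "{C1..C2 u0 b C1} \<subseteq> ?g ` {0..b}"
  proof
    fix y assume "y \<in> {C1..C2 u0 b C1}"
    then have "?g 0 \<le> y" "y \<le> ?g b" by (auto simp: g_def C2_def U0_def)
    then obtain x where "0 \<le> x" "x \<le> b" "?g x = y"
      using IVT'[of ?g 0 y b] contg b by auto
    then show "y \<in> ?g ` {0..b}" by auto
  qed
  have inv_in: "inv_into {0..b} ?g y \<in> {0..b}" if "y \<in> {C1..C2 u0 b C1}" for y
    using surj that by (intro inv_into_into) auto
  have "continuous_on (?g ` {0..b}) (inv_into {0..b} ?g)"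
    by (rule continuous_on_inv[OF contg]) (use inj in auto)
  then have "continuous_on {C1..C2 u0 b C1} (inv_into {0..b} ?g)"
    by (rule continuous_on_subset) (rule surj)
  then show "continuous_on {C1..C2 u0 b C1} (V0 \<beta> u0 b C1)"
    unfolding V0_def v0_def
    using inv_in by (intro continuous_on_diff continuous_on_const continuous_on_compose2[OF contu]) auto
  show "V0 \<beta> u0 b C1 y \<ge> 0" if "y \<in> {C1..C2 u0 b C1}"
    using pos(1)[OF inv_in[OF that]] by (simp add: V0_def v0_def)
  have "?g 0 = C1" by (simp add: g_def)
  then have "inv_into {0..b} ?g C1 = 0"
    using inv_into_f_f[OF inj, of 0] b by simp
  then show "V0 \<beta> u0 b C1 C1 > 0"
    using above[of 0] b by (simp add: V0_def v0_def)
qed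

text \<open>The two forms of \<open>Z\<close> at the initial time, where \<open>C = 1\<close>.\<close>
lemma exp_tail_eq_affine_tail:
  assumes "D > 0" "continuous_on {C1..C2 u0 b C1} (V0 \<beta> u0 b C1)" "y \<in> {C1..C2 u0 b C1}"
  shows "exp (1 / D * integral {y..C2 u0 b C1} (V0 \<beta> u0 b C1)) =
    1 + 1 / D * integral {y..C2 u0 b C1} (F D \<beta> u0 b C1)"
  using exp_tail_integral(2)[OF _ assms(2,3), of D] assms(1)
  by (simp add: F_def[abs_def])

section \<open>Translation of the side conditions\<close>

lemma (in hopf_cole_pair) transformed_pair: "transformed D \<sigma> y0 y1 V w"
  unfolding transformed_def
  using int_w w_eq Z_V continuous_on_slice[OF classical_V]
  by (auto intro!: integrable_continuous_real simp: algebra_simps)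

text \<open>The differential equations and the conditions at \<open>y0\<close> and \<open>y1\<close> correspond to each other through
  \<open>w = Z V\<close> and \<open>w\<^sub>y = Z (V\<^sub>y - V\<^sup>2 / D)\<close>. The formula for \<open>y1\<close> takes the logarithm of \<open>C\<close>. For \<open>y0\<close> one
  divides the two relations and inserts \<open>V = f - \<beta>\<close>: then \<open>w\<^sub>y / w = V\<^sub>y / (f - \<beta>) - (f - \<beta>) / D\<close>, and
  multiplication by \<open>1 - \<beta> / f = (f - \<beta>) / f\<close> gives
  \<open>f - D V\<^sub>y / f = 2 \<beta> - \<beta>\<^sup>2 / f - D (w\<^sub>y / w) (1 - \<beta> / f)\<close>.\<close>
lemma (in hopf_cole_pair) problem_iff:
  assumes D: "D > 0" and \<beta>: "\<beta> > 0" and \<sigma>: "\<sigma> > 0"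
    and f: "continuous_on {0..\<sigma>} f" "\<And>t. t \<in> {0..\<sigma>} \<Longrightarrow> f t > \<beta>"
    and V0: "continuous_on {C1..C2 u0 b C1} (V0 \<beta> u0 b C1)"
  shows "V_problem D \<beta> b \<sigma> C1 f u0 y0 y1 V \<longleftrightarrow> w_problem D \<beta> b \<sigma> C1 f u0 y0 y1 w"
proof -
  let ?C = "C_fun y0 y1 w"
  let ?Vy = "part_y y0 y1 V" and ?wy = "part_y y0 y1 w"
  note order = classicalD(3)[OF classical_V]
  have C_pos: "?C t > 0" if "t \<in> {0..\<sigma>}" for t
    using C_exp[OF that] by simp
  have edge1: "(y0 t, t) \<in> closed_dom {0<..\<sigma>} y0 y1" "(y1 t, t) \<in> closed_dom {0<..\<sigma>} y0 y1"
    and edge0: "(y0 t, t) \<in> closed_dom {0..\<sigma>} y0 y1" "(y1 t, t) \<in> closed_dom {0..\<sigma>} y0 y1"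
    if "t \<in> {0<..\<sigma>}" for t
    using order[of t] that by (auto simp: closed_dom_def)
  have pde: "part_t \<sigma> V y t = D * part_yy y0 y1 V y t - 2 * V y t * ?Vy y t \<longleftrightarrow>
      part_t \<sigma> w y t = D * part_yy y0 y1 w y t" if *: "(y, t) \<in> open_dom {0<..\<sigma>} y0 y1" for y t
  proof -
    have "(y, t) \<in> closed_dom {0..\<sigma>} y0 y1"
      using * by (auto simp: open_dom_def closed_dom_def)
    then show ?thesis
      using heat_eq[OF *] Z_pos[of y t] by auto
  qed
  have bc0: "V (y0 t) t = f t - \<beta> \<longleftrightarrow>
      w (y0 t) t = (f t - \<beta>) * (?C t + 1 / D * integral {y0 t..y1 t} (\<lambda>\<xi>. w \<xi> t))"
    if t: "t \<in> {0<..\<sigma>}" for t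
    using w_eq[OF edge0(1)[OF t]] Z_w[OF edge0(1)[OF t]] Z_pos[OF edge0(1)[OF t]]
    by (auto simp: mult.commute)
  have w_zero: "w (y1 t) t = 0" if t: "t \<in> {0<..\<sigma>}" for t
    using w_eq[OF edge0(2)[OF t]] V_zero[OF t] by simp
  have slope: "D * (?Vy (y1 t) t / \<beta>) = D * ?wy (y1 t) t / (\<beta> * ?C t)" if t: "t \<in> {0<..\<sigma>}" for t
    using w_y_eq[OF edge1(2)[OF t]] V_zero[OF t] Z_w[OF edge0(2)[OF t]] C_pos[of t] t by simp
  have ic: "(\<forall>y\<in>{C1..C2 u0 b C1}. V y 0 = V0 \<beta> u0 b C1 y) \<longleftrightarrow>
      (\<forall>y\<in>{C1..C2 u0 b C1}. w y 0 = F D \<beta> u0 b C1 y)"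
    if ends: "y0 0 = C1" "y1 0 = C2 u0 b C1"
  proof -
    have dom: "(y, 0) \<in> closed_dom {0..\<sigma>} y0 y1" if "y \<in> {C1..C2 u0 b C1}" for y
      using that ends \<sigma> by (auto simp: closed_dom_def)
    have C0: "?C 0 = 1" by (simp add: C_fun_def)
    show ?thesis
    proof (intro iffI ballI)
      fix y assume V: "\<forall>y\<in>{C1..C2 u0 b C1}. V y 0 = V0 \<beta> u0 b C1 y" and y: "y \<in> {C1..C2 u0 b C1}"
      have "integral {y..C2 u0 b C1} (\<lambda>\<xi>. V \<xi> 0) = integral {y..C2 u0 b C1} (V0 \<beta> u0 b C1)"
        by (rule integral_cong) (use V y in auto)
      then show "w y 0 = F D \<beta> u0 b C1 y"
        using w_eq[OF dom[OF y]] Z_V[OF dom[OF y]] V y C0 ends(2)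
        by (simp add: eta_def F_def)
    next
      fix y assume w: "\<forall>y\<in>{C1..C2 u0 b C1}. w y 0 = F D \<beta> u0 b C1 y" and y: "y \<in> {C1..C2 u0 b C1}"
      have "integral {y..C2 u0 b C1} (\<lambda>\<xi>. w \<xi> 0) = integral {y..C2 u0 b C1} (F D \<beta> u0 b C1)"
        by (rule integral_cong) (use w y in auto)
      then have "Z y 0 = exp (1 / D * integral {y..C2 u0 b C1} (V0 \<beta> u0 b C1))"
        using Z_w[OF dom[OF y]] C0 ends(2) exp_tail_eq_affine_tail[OF D V0 y] by simp
      then show "V y 0 = V0 \<beta> u0 b C1 y"
        using w_eq[OF dom[OF y]] w y by (simp add: F_def)
    qed
  qed
  let ?a = "\<lambda>\<tau>. f \<tau> - D * (?Vy (y0 \<tau>) \<tau> / f \<tau>)"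
  let ?r = "\<lambda>\<tau>. ?wy (y0 \<tau>) \<tau> / w (y0 \<tau>) \<tau> * (1 - \<beta> / f \<tau>)"
  have lower: "(?a integrable_on {0..\<sigma>} \<longleftrightarrow> ?r integrable_on {0..\<sigma>}) \<and>
      (?a integrable_on {0..\<sigma>} \<longrightarrow> (\<forall>t\<in>{0..\<sigma>}. C1 - 2 * \<beta> * t + integral {0..t} ?a =
        C1 - \<beta>\<^sup>2 * integral {0..t} (\<lambda>\<tau>. 1 / f \<tau>) - D * integral {0..t} ?r))"
    if V: "\<forall>t\<in>{0<..\<sigma>}. V (y0 t) t = f t - \<beta>"
  proof -
    have eq: "?a \<tau> = 2 * \<beta> - \<beta>\<^sup>2 * (1 / f \<tau>) - D * ?r \<tau>" if \<tau>: "\<tau> \<in> {0<..\<sigma>}" for \<tau>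
    proof -
      have Vt: "V (y0 \<tau>) \<tau> = f \<tau> - \<beta>" and fpos: "f \<tau> - \<beta> > 0" "f \<tau> > 0"
        using V f(2)[of \<tau>] \<beta> \<tau> by auto
      have "?wy (y0 \<tau>) \<tau> / w (y0 \<tau>) \<tau> = (?Vy (y0 \<tau>) \<tau> - (f \<tau> - \<beta>)\<^sup>2 / D) / (f \<tau> - \<beta>)"
        using w_y_eq[OF edge1(1)[OF \<tau>]] w_eq[OF edge0(1)[OF \<tau>]] Z_pos[OF edge0(1)[OF \<tau>]] Vt
        by simp
      moreover have "1 - \<beta> / f \<tau> = (f \<tau> - \<beta>) / f \<tau>"
        using fpos by (simp add: field_simps)
      ultimately have "?r \<tau> = (?Vy (y0 \<tau>) \<tau> - (f \<tau> - \<beta>)\<^sup>2 / D) / f \<tau>"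
        using fpos by simp
      then show ?thesis
        using fpos D by (simp add: field_simps power2_eq_square)
    qed
    have cont: "continuous_on {0..\<sigma>} (\<lambda>\<tau>. 1 / f \<tau>)"
      using f \<beta> by (intro continuous_intros) force+
    have int_f: "(\<lambda>\<tau>. 1 / f \<tau>) integrable_on {0..t}" if "t \<in> {0..\<sigma>}" for t
      using that by (intro integrable_continuous_real continuous_on_subset[OF cont]) auto
    have int_sub: "h integrable_on {0..t}" if "h integrable_on {0..\<sigma>}" "t \<in> {0..\<sigma>}"
      for h :: "real \<Rightarrow> real" and t
      using that by (auto intro: integrable_on_subinterval)
    have int_fin: "integral {0..t} ?a =
        2 * \<beta> * t - \<beta>\<^sup>2 * integral {0..t} (\<lambda>\<tau>. 1 / f \<tau>) - D * integral {0..t} ?r"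
      and int_a: "?a integrable_on {0..t}"
      if r: "?r integrable_on {0..\<sigma>}" and t: "t \<in> {0..\<sigma>}" for t
    proof -
      have c: "((\<lambda>\<tau>. 2 * \<beta>) has_integral 2 * \<beta> * t) {0..t}"
        using has_integral_const_real[of "2 * \<beta>" 0 t] t by (simp add: mult.commute)
      note has_integral_diff[OF has_integral_diff[OF c
            has_integral_mult_right[OF integrable_integral[OF int_f[OF t]], of "\<beta>\<^sup>2"]]
          has_integral_mult_right[OF integrable_integral[OF int_sub[OF r t]], of D]]
      then have "(?a has_integral
          2 * \<beta> * t - \<beta>\<^sup>2 * integral {0..t} (\<lambda>\<tau>. 1 / f \<tau>) - D * integral {0..t} ?r) {0..t}"
        by (rule has_integral_spike[of "{0}", rotated 2]) (use eq t in auto)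
      then show "integral {0..t} ?a =
          2 * \<beta> * t - \<beta>\<^sup>2 * integral {0..t} (\<lambda>\<tau>. 1 / f \<tau>) - D * integral {0..t} ?r"
        "?a integrable_on {0..t}"
        by (auto simp: integral_unique)
    qed
    have int_r: "?r integrable_on {0..\<sigma>}" if a: "?a integrable_on {0..\<sigma>}"
    proof (rule integrable_spike[of _ _ "{0}"])
      show "(\<lambda>\<tau>. (1 / D) * (2 * \<beta> - \<beta>\<^sup>2 * (1 / f \<tau>) - ?a \<tau>)) integrable_on {0..\<sigma>}"
        using \<sigma> by (intro integrable_on_mult_right integrable_diff integrable_const_ivl int_f a) auto
      show "?r \<tau> = (1 / D) * (2 * \<beta> - \<beta>\<^sup>2 * (1 / f \<tau>) - ?a \<tau>)" if "\<tau> \<in> {0..\<sigma>} - {0}" for \<tau>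
        using eq[of \<tau>] that D by simp
    qed simp
    show ?thesis
      using int_fin int_a[of \<sigma>] int_r \<sigma> by auto
  qed
  have upper: "X - D * (\<beta> + 1) / \<beta>\<^sup>2 * integral {0..t} (\<lambda>\<tau>. ?Vy (y1 \<tau>) \<tau>) =
      X + D * (\<beta> + 1) / \<beta>\<^sup>2 * ln (1 - integral {0..t} (\<lambda>\<tau>. ?wy (y1 \<tau>) \<tau>))"
    if "t \<in> {0..\<sigma>}" for t X
    using C_exp[OF that] by (simp add: C_fun_def)
  show ?thesis
  proof
    assume "V_problem D \<beta> b \<sigma> C1 f u0 y0 y1 V"
    note P = this[unfolded V_problem_def]
    have P_pde: "\<forall>(y, t)\<in>open_dom {0<..\<sigma>} y0 y1.
        part_t \<sigma> V y t = D * part_yy y0 y1 V y t - 2 * V y t * ?Vy y t"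
      and P_bc: "\<forall>t\<in>{0<..\<sigma>}. V (y0 t) t = f t - \<beta> \<and> V (y1 t) t = 0 \<and>
        D * (?Vy (y1 t) t / \<beta>) = (\<beta> * (1 - \<beta>) - \<beta> * time_deriv \<sigma> y1 t) / (\<beta> + 1)"
      and P_ic: "\<forall>y\<in>{C1..C2 u0 b C1}. V y 0 = V0 \<beta> u0 b C1 y"
      and ends: "y0 0 = C1" "y1 0 = C2 u0 b C1"
      and P_int: "?a integrable_on {0..\<sigma>}"
      and P_fb: "\<forall>t\<in>{0..\<sigma>}. y0 t = C1 - 2 * \<beta> * t + integral {0..t} ?a \<and>
          y1 t = C2 u0 b C1 + (1 - \<beta>) * t -
            D * (\<beta> + 1) / \<beta>\<^sup>2 * integral {0..t} (\<lambda>\<tau>. ?Vy (y1 \<tau>) \<tau>)"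
      using P by - (elim conjE, assumption)+
    have bc: "\<forall>t\<in>{0<..\<sigma>}. V (y0 t) t = f t - \<beta>" using P_bc by simp
    show "w_problem D \<beta> b \<sigma> C1 f u0 y0 y1 w"
      unfolding w_problem_def
    proof (intro conjI)
      show "\<forall>(y, t)\<in>open_dom {0<..\<sigma>} y0 y1. part_t \<sigma> w y t = D * part_yy y0 y1 w y t"
        using P_pde pde by fast
      show "\<forall>y\<in>{C1..C2 u0 b C1}. w y 0 = F D \<beta> u0 b C1 y"
        using P_ic ic[OF ends] by simp
      show "\<forall>t\<in>{0<..\<sigma>}. w (y0 t) t =
          (f t - \<beta>) * (?C t + 1 / D * integral {y0 t..y1 t} (\<lambda>\<xi>. w \<xi> t)) \<and> w (y1 t) t = 0 \<and>
          D * ?wy (y1 t) t / (\<beta> * ?C t) = (\<beta> * (1 - \<beta>) - \<beta> * time_deriv \<sigma> y1 t) / (\<beta> + 1)"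
        using P_bc bc0 w_zero slope by (metis (no_types, lifting))
      show "?r integrable_on {0..\<sigma>}"
        using lower[OF bc] P_int by simp
      show "\<forall>t\<in>{0..\<sigma>}. y0 t = C1 - \<beta>\<^sup>2 * integral {0..t} (\<lambda>\<tau>. 1 / f \<tau>) - D * integral {0..t} ?r \<and>
          y1 t = C2 u0 b C1 + (1 - \<beta>) * t +
            D * (\<beta> + 1) / \<beta>\<^sup>2 * ln (1 - integral {0..t} (\<lambda>\<tau>. ?wy (y1 \<tau>) \<tau>))"
      proof (intro ballI conjI)
        fix t assume t: "t \<in> {0..\<sigma>}"
        show "y0 t = C1 - \<beta>\<^sup>2 * integral {0..t} (\<lambda>\<tau>. 1 / f \<tau>) - D * integral {0..t} ?r"
          by (rule trans[OF conjunct1[OF bspec[OF P_fb t]]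
                bspec[OF mp[OF conjunct2[OF lower[OF bc]] P_int] t]])
        show "y1 t = C2 u0 b C1 + (1 - \<beta>) * t +
            D * (\<beta> + 1) / \<beta>\<^sup>2 * ln (1 - integral {0..t} (\<lambda>\<tau>. ?wy (y1 \<tau>) \<tau>))"
          by (rule trans[OF conjunct2[OF bspec[OF P_fb t]] upper[OF t]])
      qed
    qed (fact ends classical_w int_w | use C_pos in blast)+
  next
    assume "w_problem D \<beta> b \<sigma> C1 f u0 y0 y1 w"
    note P = this[unfolded w_problem_def]
    have P_pde: "\<forall>(y, t)\<in>open_dom {0<..\<sigma>} y0 y1. part_t \<sigma> w y t = D * part_yy y0 y1 w y t"
      and P_bc: "\<forall>t\<in>{0<..\<sigma>}. w (y0 t) t =
          (f t - \<beta>) * (?C t + 1 / D * integral {y0 t..y1 t} (\<lambda>\<xi>. w \<xi> t)) \<and> w (y1 t) t = 0 \<and>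
          D * ?wy (y1 t) t / (\<beta> * ?C t) = (\<beta> * (1 - \<beta>) - \<beta> * time_deriv \<sigma> y1 t) / (\<beta> + 1)"
      and P_ic: "\<forall>y\<in>{C1..C2 u0 b C1}. w y 0 = F D \<beta> u0 b C1 y"
      and ends: "y0 0 = C1" "y1 0 = C2 u0 b C1"
      and P_int: "?r integrable_on {0..\<sigma>}"
      and P_fb: "\<forall>t\<in>{0..\<sigma>}.
          y0 t = C1 - \<beta>\<^sup>2 * integral {0..t} (\<lambda>\<tau>. 1 / f \<tau>) - D * integral {0..t} ?r \<and>
          y1 t = C2 u0 b C1 + (1 - \<beta>) * t +
            D * (\<beta> + 1) / \<beta>\<^sup>2 * ln (1 - integral {0..t} (\<lambda>\<tau>. ?wy (y1 \<tau>) \<tau>))"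
      using P by - (elim conjE, assumption)+
    have bc: "\<forall>t\<in>{0<..\<sigma>}. V (y0 t) t = f t - \<beta>"
      using P_bc bc0 by (metis (no_types, lifting))
    have int_a: "?a integrable_on {0..\<sigma>}"
      using lower[OF bc] P_int by simp
    show "V_problem D \<beta> b \<sigma> C1 f u0 y0 y1 V"
      unfolding V_problem_def
    proof (intro conjI)
      show "\<forall>(y, t)\<in>open_dom {0<..\<sigma>} y0 y1.
          part_t \<sigma> V y t = D * part_yy y0 y1 V y t - 2 * V y t * ?Vy y t"
        using P_pde pde by fast
      show "\<forall>y\<in>{C1..C2 u0 b C1}. V y 0 = V0 \<beta> u0 b C1 y"
        using P_ic ic[OF ends] by simp
      show "\<forall>t\<in>{0<..\<sigma>}. V (y0 t) t = f t - \<beta> \<and> V (y1 t) t = 0 \<and>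
          D * (?Vy (y1 t) t / \<beta>) = (\<beta> * (1 - \<beta>) - \<beta> * time_deriv \<sigma> y1 t) / (\<beta> + 1)"
        using P_bc bc V_zero slope by (metis (no_types, lifting))
      show "\<forall>t\<in>{0..\<sigma>}. y0 t = C1 - 2 * \<beta> * t + integral {0..t} ?a \<and>
          y1 t = C2 u0 b C1 + (1 - \<beta>) * t -
            D * (\<beta> + 1) / \<beta>\<^sup>2 * integral {0..t} (\<lambda>\<tau>. ?Vy (y1 \<tau>) \<tau>)"
      proof (intro ballI conjI)
        fix t assume t: "t \<in> {0..\<sigma>}"
        show "y0 t = C1 - 2 * \<beta> * t + integral {0..t} ?a"
          by (rule trans[OF conjunct1[OF bspec[OF P_fb t]]
                bspec[OF mp[OF conjunct2[OF lower[OF bc]] int_a] t, symmetric]])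
        show "y1 t = C2 u0 b C1 + (1 - \<beta>) * t -
            D * (\<beta> + 1) / \<beta>\<^sup>2 * integral {0..t} (\<lambda>\<tau>. ?Vy (y1 \<tau>) \<tau>)"
          by (rule trans[OF conjunct2[OF bspec[OF P_fb t]] upper[OF t, symmetric]])
      qed
    qed (fact ends classical_V int_V int_a)+
  qed
qed

section \<open>From a solution of either problem to a pair\<close>

text \<open>The free boundary formulas are equations \<open>y0 t = \<dots>\<close> whose right-hand sides contain \<open>y0\<close>
  again. As rewrite rules they do not terminate, so the conditions are separated by elimination rules.\<close>
lemma V_problemD:
  assumes "V_problem D \<beta> b \<sigma> C1 f u0 y0 y1 V"
  shows "classical \<sigma> y0 y1 V"
    and "(y, t) \<in> open_dom {0<..\<sigma>} y0 y1 \<Longrightarrow>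
      part_t \<sigma> V y t = D * part_yy y0 y1 V y t - 2 * V y t * part_y y0 y1 V y t"
    and "t \<in> {0<..\<sigma>} \<Longrightarrow> V (y1 t) t = 0"
    and "(\<lambda>\<tau>. part_y y0 y1 V (y1 \<tau>) \<tau>) integrable_on {0..\<sigma>}"
proof -
  note P = assms[unfolded V_problem_def]
  show "classical \<sigma> y0 y1 V" and "(\<lambda>\<tau>. part_y y0 y1 V (y1 \<tau>) \<tau>) integrable_on {0..\<sigma>}"
    using P by - (elim conjE, assumption)+
  have "\<forall>(y, t)\<in>open_dom {0<..\<sigma>} y0 y1.
      part_t \<sigma> V y t = D * part_yy y0 y1 V y t - 2 * V y t * part_y y0 y1 V y t"
    using P by (elim conjE)
  then show "part_t \<sigma> V y t = D * part_yy y0 y1 V y t - 2 * V y t * part_y y0 y1 V y t"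
    if "(y, t) \<in> open_dom {0<..\<sigma>} y0 y1"
    using that by fast
  show "V (y1 t) t = 0" if "t \<in> {0<..\<sigma>}"
    using P that by (elim conjE) (drule (1) bspec, elim conjE)
qed

lemma w_problemD:
  assumes "w_problem D \<beta> b \<sigma> C1 f u0 y0 y1 w"
  shows "classical \<sigma> y0 y1 w"
    and "(y, t) \<in> open_dom {0<..\<sigma>} y0 y1 \<Longrightarrow> part_t \<sigma> w y t = D * part_yy y0 y1 w y t"
    and "t \<in> {0<..\<sigma>} \<Longrightarrow> w (y1 t) t = 0"
    and "t \<in> {0<..\<sigma>} \<Longrightarrow> w (y0 t) t =
      (f t - \<beta>) * (C_fun y0 y1 w t + 1 / D * integral {y0 t..y1 t} (\<lambda>\<xi>. w \<xi> t))"
    and "y \<in> {C1..C2 u0 b C1} \<Longrightarrow> w y 0 = F D \<beta> u0 b C1 y"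
    and "y0 0 = C1" and "y1 0 = C2 u0 b C1"
    and "(\<lambda>\<tau>. part_y y0 y1 w (y1 \<tau>) \<tau>) integrable_on {0..\<sigma>}"
    and "t \<in> {0..\<sigma>} \<Longrightarrow> C_fun y0 y1 w t > 0"
proof -
  note P = assms[unfolded w_problem_def]
  show "classical \<sigma> y0 y1 w" and "(\<lambda>\<tau>. part_y y0 y1 w (y1 \<tau>) \<tau>) integrable_on {0..\<sigma>}"
    and "y0 0 = C1" and "y1 0 = C2 u0 b C1"
    using P by - (elim conjE, assumption)+
  have pde: "\<forall>(y, t)\<in>open_dom {0<..\<sigma>} y0 y1. part_t \<sigma> w y t = D * part_yy y0 y1 w y t"
    and bc: "\<forall>t\<in>{0<..\<sigma>}. w (y0 t) t =
        (f t - \<beta>) * (C_fun y0 y1 w t + 1 / D * integral {y0 t..y1 t} (\<lambda>\<xi>. w \<xi> t)) \<and>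
      w (y1 t) t = 0 \<and> D * part_y y0 y1 w (y1 t) t / (\<beta> * C_fun y0 y1 w t) =
        (\<beta> * (1 - \<beta>) - \<beta> * time_deriv \<sigma> y1 t) / (\<beta> + 1)"
    and ic: "\<forall>y\<in>{C1..C2 u0 b C1}. w y 0 = F D \<beta> u0 b C1 y"
    and C: "\<forall>t\<in>{0..\<sigma>}. C_fun y0 y1 w t > 0"
    using P by - (elim conjE, assumption)+
  show "part_t \<sigma> w y t = D * part_yy y0 y1 w y t" if "(y, t) \<in> open_dom {0<..\<sigma>} y0 y1"
    using pde that by fast
  show "w (y0 t) t = (f t - \<beta>) * (C_fun y0 y1 w t + 1 / D * integral {y0 t..y1 t} (\<lambda>\<xi>. w \<xi> t))"
    "w (y1 t) t = 0" if "t \<in> {0<..\<sigma>}"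
    using bspec[OF bc that] by blast+
  show "y \<in> {C1..C2 u0 b C1} \<Longrightarrow> w y 0 = F D \<beta> u0 b C1 y" "t \<in> {0..\<sigma>} \<Longrightarrow> C_fun y0 y1 w t > 0"
    using ic C by blast+
qed

text \<open>Differentiating \<open>w = C V \<eta>\<close> at \<open>y1\<close>, where \<open>V = 0\<close> and \<open>\<eta> = 1\<close>, gives \<open>w\<^sub>y = C V\<^sub>y\<close>. Thus \<open>C\<close>
  solves a linear differential equation whose coefficient depends on \<open>V\<close> alone, and \<open>w\<close> is the
  function constructed explicitly from \<open>V\<close>.\<close>
lemma hopf_cole_pair_of_transformed_V:
  assumes D: "D > 0" and V: "V_problem D \<beta> b \<sigma> C1 f u0 y0 y1 V"
    and tr: "transformed D \<sigma> y0 y1 V w"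
  shows "\<exists>Z. hopf_cole_pair D \<sigma> y0 y1 V w Z"
proof -
  let ?C = "C_fun y0 y1 w"
  let ?p = "\<lambda>\<tau>. part_y y0 y1 V (y1 \<tau>) \<tau>"
  note V = V_problemD[OF V]
  note U = classicalD[OF V(1)]
  have int: "(\<lambda>\<tau>. part_y y0 y1 w (y1 \<tau>) \<tau>) integrable_on {0..\<sigma>}"
    and w: "\<And>y t. (y, t) \<in> closed_dom {0..\<sigma>} y0 y1 \<Longrightarrow> w y t = ?C t * V y t * eta D y1 V y t"
    using tr unfolding transformed_def by auto
  have slope: "part_y y0 y1 w (y1 t) t = ?C t * ?p t" if t: "t \<in> {0<..\<sigma>}" for t
  proof -
    have t': "t \<in> {0..\<sigma>}" "y0 t < y1 t" using t U(3)[of t] by auto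
    have y1: "(y1 t, t) \<in> closed_dom {0<..\<sigma>} y0 y1" using t t' by (simp add: closed_dom_def)
    have eta: "((\<lambda>\<xi>. eta D y1 V \<xi> t) has_real_derivative 0) (at (y1 t) within {y0 t..y1 t})"
      using exp_tail_integral(1)[OF _ continuous_on_slice[OF V(1) t'(1)], of D "y1 t"] V(3)[OF t] t' D
      unfolding eta_def by simp
    have "((\<lambda>\<xi>. ?C t * (V \<xi> t * eta D y1 V \<xi> t)) has_real_derivative ?C t * ?p t)
        (at (y1 t) within {y0 t..y1 t})"
      by (rule DERIV_cong[OF DERIV_cmult[OF DERIV_mult[OF U(5)[OF y1] eta]]]) (simp add: eta_def)
    then have "((\<lambda>\<xi>. w \<xi> t) has_real_derivative ?C t * ?p t) (at (y1 t) within {y0 t..y1 t})"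
      by (rule has_field_derivative_transform_within[of _ _ _ _ 1])
        (use t' w in \<open>auto simp: closed_dom_def\<close>)
    then show ?thesis
      unfolding part_y_def[of _ _ w] using t' by (intro vector_derivative_real_within) auto
  qed
  have contC: "continuous_on {0..\<sigma>} ?C"
    unfolding C_fun_def by (intro continuous_intros indefinite_integral_continuous_1 int)
  have "continuous_on {0<..\<sigma>} (\<lambda>t. ?C t * ?p t)"
    by (intro continuous_on_mult continuous_on_subset[OF contC] continuous_on_boundary_slope[OF V(1)]) auto
  then have "continuous_on {0<..\<sigma>} (\<lambda>\<tau>. part_y y0 y1 w (y1 \<tau>) \<tau>)"
    by (rule continuous_on_eq) (simp add: slope)
  note der = has_derivative_integral_from_singular_endpoint[OF this int]
  have C: "(?C has_real_derivative - (?C t * ?p t)) (at t within {0..\<sigma>})" if "t \<in> {0<..\<sigma>}" for t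
  proof -
    have "?C = (\<lambda>t. 1 - integral {0..t} (\<lambda>\<tau>. part_y y0 y1 w (y1 \<tau>) \<tau>))"
      by (simp add: C_fun_def fun_eq_iff)
    then show ?thesis
      using DERIV_diff[OF DERIV_const der[OF that], of 1] slope[OF that] by simp
  qed
  have "?C t = exp (- integral {0..t} ?p)" if "t \<in> {0..\<sigma>}" for t
    by (rule linear_ode_unique[OF contC indefinite_integral_continuous_1[OF V(4)] C
          has_derivative_integral_from_singular_endpoint[OF continuous_on_boundary_slope[OF V(1)] V(4)]])
      (use that in \<open>auto simp: C_fun_def\<close>)
  then have "w y t = exp (- integral {0..t} ?p) * V y t * eta D y1 V y t"
    if "(y, t) \<in> closed_dom {0..\<sigma>} y0 y1" for y t
    using w[OF that] that by (auto simp: closed_dom_def)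
  with hopf_cole_pair_from_V[OF D V] show ?thesis
    by blast
qed

text \<open>Of \<open>V\<close> only integrability in \<open>y\<close> is known at first. This makes \<open>\<eta>\<close> continuous, hence also
  \<open>V = w / (C \<eta>)\<close>, and then the exponential form of \<open>Z\<close> can be converted into the affine one. As
  \<open>\<eta>\<close> is an exponential, the positivity of \<open>Z\<close> is immediate here.\<close>
lemma hopf_cole_pair_of_transformed_w:
  assumes D: "D > 0" and w: "w_problem D \<beta> b \<sigma> C1 f u0 y0 y1 w"
    and tr: "transformed D \<sigma> y0 y1 V w"
  shows "\<exists>Z. hopf_cole_pair D \<sigma> y0 y1 V w Z"
proof -
  let ?C = "C_fun y0 y1 w"
  let ?Z = "\<lambda>y t. ?C t * eta D y1 V y t"
  note W = w_problemD[OF w]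
  have intV: "\<And>t. t \<in> {0..\<sigma>} \<Longrightarrow> (\<lambda>\<xi>. V \<xi> t) integrable_on {y0 t..y1 t}"
    and w_eq: "\<And>y t. (y, t) \<in> closed_dom {0..\<sigma>} y0 y1 \<Longrightarrow> w y t = ?C t * V y t * eta D y1 V y t"
    using tr unfolding transformed_def by auto
  have pos: "?Z y t > 0" if "(y, t) \<in> closed_dom {0..\<sigma>} y0 y1" for y t
    using W(9)[of t] that by (auto simp: closed_dom_def eta_def)
  have V: "V y t = w y t / ?Z y t" if "(y, t) \<in> closed_dom {0..\<sigma>} y0 y1" for y t
  proof -
    have "V y t * ?Z y t = w y t" using w_eq[OF that] by (simp add: mult_ac)
    then show ?thesis using pos[OF that] by (metis less_irrefl nonzero_eq_divide_eq)
  qed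
  have "?Z y t = ?C t + 1 / D * integral {y..y1 t} (\<lambda>\<xi>. w \<xi> t)"
    if dom: "(y, t) \<in> closed_dom {0..\<sigma>} y0 y1" for y t
  proof -
    have t: "t \<in> {0..\<sigma>}" "y \<in> {y0 t..y1 t}" using dom by (auto simp: closed_dom_def)
    have "continuous_on {y0 t..y1 t} (\<lambda>\<xi>. w \<xi> t / ?Z \<xi> t)"
      unfolding eta_def using W(9)[OF t(1)]
      by (intro continuous_intros continuous_on_slice[OF W(1) t(1)]
          indefinite_integral_continuous_1' intV t(1)) auto
    then have contV: "continuous_on {y0 t..y1 t} (\<lambda>\<xi>. V \<xi> t)"
      by (rule continuous_on_eq) (use V t in \<open>auto simp: closed_dom_def\<close>)
    have "integral {y..y1 t} (\<lambda>\<xi>. w \<xi> t) =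
        integral {y..y1 t} (\<lambda>\<xi>. ?C t * (V \<xi> t * eta D y1 V \<xi> t))"
      by (rule integral_cong) (use t in \<open>auto simp: w_eq closed_dom_def\<close>)
    then have int_w: "integral {y..y1 t} (\<lambda>\<xi>. w \<xi> t) =
        ?C t * integral {y..y1 t} (\<lambda>\<xi>. V \<xi> t * eta D y1 V \<xi> t)"
      by simp
    have eta_eq: "eta D y1 V y t =
        1 + 1 / D * integral {y..y1 t} (\<lambda>\<xi>. V \<xi> t * eta D y1 V \<xi> t)"
      using exp_tail_integral(2)[OF _ contV t(2), of D] D by (simp add: eta_def)
    show ?thesis
      unfolding int_w by (subst eta_eq) (simp add: algebra_simps)
  qed
  from hopf_cole_pair_from_w[OF D W(1,2,3,8,9) this pos V] show ?thesis
    by blast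
qed

text \<open>At the first time \<open>T\<close> at which \<open>w\<close> is not positive on \<open>y0\<close>, continuity gives \<open>w = 0\<close> there; so up
  to \<open>T\<close> the minimum principle yields \<open>w \<ge> 0\<close>, whence \<open>Z \<ge> C > 0\<close> at \<open>T\<close>. The boundary condition
  \<open>w = (f - \<beta>) Z\<close> then contradicts \<open>w = 0\<close>. Hence \<open>w\<close> is positive on \<open>y0\<close> and nonnegative everywhere.\<close>
lemma w_problem_denominator_pos:
  assumes D: "D > 0" and w: "w_problem D \<beta> b \<sigma> C1 f u0 y0 y1 w" and \<sigma>: "\<sigma> > 0"
    and f: "\<And>t. t \<in> {0..\<sigma>} \<Longrightarrow> f t > \<beta>"
    and V0_nonneg: "\<And>y. y \<in> {C1..C2 u0 b C1} \<Longrightarrow> V0 \<beta> u0 b C1 y \<ge> 0"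
    and V0_pos: "V0 \<beta> u0 b C1 C1 > 0"
    and yt: "(y, t) \<in> closed_dom {0..\<sigma>} y0 y1"
  shows "C_fun y0 y1 w t + 1 / D * integral {y..y1 t} (\<lambda>\<xi>. w \<xi> t) > 0"
proof -
  note W = w_problemD[OF w]
  note U = classicalD[OF W(1)]
  have init: "w y 0 \<ge> 0" if "y \<in> {y0 0..y1 0}" for y
    using W(5)[of y] V0_nonneg[of y] that W(6,7) by (simp add: F_def)
  have init_pos: "w (y0 0) 0 > 0"
    using W(5)[of C1] V0_pos U(3)[of 0] W(6,7) \<sigma> by (simp add: F_def)
  have right: "w (y1 t) t \<ge> 0" if "t \<in> {0..\<sigma>}" for t
    using init[of "y1 0"] W(3)[of t] U(3)[of 0] \<sigma> that by (cases "t = 0") auto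
  have Z_pos: "C_fun y0 y1 w t + 1 / D * integral {y..y1 t} (\<lambda>\<xi>. w \<xi> t) > 0"
    if t: "t \<in> {0..\<sigma>}" "y \<in> {y0 t..y1 t}" and nonneg: "\<And>\<xi>. \<xi> \<in> {y0 t..y1 t} \<Longrightarrow> w \<xi> t \<ge> 0" for y t
  proof -
    have "(\<lambda>\<xi>. w \<xi> t) integrable_on {y..y1 t}"
      using t by (intro integrable_continuous_real continuous_on_subset[OF continuous_on_slice[OF W(1) t(1)]]) auto
    then have "integral {y..y1 t} (\<lambda>\<xi>. w \<xi> t) \<ge> 0"
      by (rule integral_nonneg) (use t nonneg in auto)
    then show ?thesis
      using W(9)[OF t(1)] D by (intro add_pos_nonneg) auto
  qed
  have nonneg: "w y t \<ge> 0"
    if "T \<le> \<sigma>" "\<And>t. t \<in> {0..T} \<Longrightarrow> w (y0 t) t \<ge> 0" "(y, t) \<in> closed_dom {0..T} y0 y1" for T y t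
    by (rule heat_minimum_principle[OF W(1) _ W(2) that(1,2) _ _ that(3)])
      (use D right init that(1) in auto)
  define h where "h t = w (y0 t) t" for t
  have conth: "continuous_on {0..\<sigma>} h"
    unfolding h_def
    by (rule continuous_on_compose2[OF U(4), of _ "\<lambda>t. (y0 t, t)", simplified])
      (use U(1,3) in \<open>auto intro!: continuous_intros simp: closed_dom_def less_imp_le\<close>)
  have h_pos: "h t > 0" if "t \<in> {0..\<sigma>}" for t
  proof (rule ccontr)
    assume "\<not> h t > 0"
    define S where "S = {t \<in> {0..\<sigma>}. h t \<le> 0}"
    have "closed S"
      unfolding S_def by (intro continuous_on_closed_Collect_le conth continuous_on_const) auto
    moreover have "S \<noteq> {}" using that \<open>\<not> h t > 0\<close> by (auto simp: S_def not_less)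
    moreover have bdd: "bdd_below S" by (auto simp: S_def bdd_below_def)
    ultimately have TS: "Inf S \<in> S" by (intro closed_contains_Inf) auto
    define T where "T = Inf S"
    have T: "T \<in> {0..\<sigma>}" "h T \<le> 0" using TS by (auto simp: S_def T_def)
    have before: "h s > 0" if "0 \<le> s" "s < T" for s
      using cInf_lower[OF _ bdd, of s] that T by (force simp: S_def T_def not_less)
    have T0: "T > 0" using T init_pos by (cases "T = 0") (auto simp: h_def)
    have hT: "h T = 0"
    proof (rule ccontr)
      assume "h T \<noteq> 0"
      then have "h T < 0" using T by simp
      moreover have "continuous_on {0..T} h" using T by (auto intro: continuous_on_subset[OF conth])
      ultimately obtain s where s: "0 \<le> s" "s \<le> T" "h s = 0"
        using IVT2'[of h T 0 0] init_pos T0 by (auto simp: h_def)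
      then show False using before[of s] \<open>h T < 0\<close> by (cases "s = T") auto
    qed
    have "w \<xi> T \<ge> 0" if "\<xi> \<in> {y0 T..y1 T}" for \<xi>
    proof (rule nonneg[of T])
      show "w (y0 t) t \<ge> 0" if "t \<in> {0..T}" for t
        using before[of t] hT that by (cases "t = T") (auto simp: h_def less_imp_le)
    qed (use T that in \<open>auto simp: closed_dom_def\<close>)
    then have "C_fun y0 y1 w T + 1 / D * integral {y0 T..y1 T} (\<lambda>\<xi>. w \<xi> T) > 0"
      using T U(3)[of T] by (intro Z_pos) auto
    then have "h T > 0"
      using W(4)[of T] f[of T] T T0 by (simp add: h_def)
    then show False using hT by simp
  qed
  have t: "t \<in> {0..\<sigma>}" "y \<in> {y0 t..y1 t}" using yt by (auto simp: closed_dom_def)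
  show ?thesis
  proof (rule Z_pos[OF t])
    show "w \<xi> t \<ge> 0" if "\<xi> \<in> {y0 t..y1 t}" for \<xi>
      by (rule nonneg[of \<sigma>]) (use t that h_pos in \<open>auto simp: h_def closed_dom_def less_imp_le\<close>)
  qed
qed

theorem theorem2p1:
  fixes D \<beta> b \<sigma> C1 :: real
    and f u0 :: "real \<Rightarrow> real"
  assumes "D > 0" and "\<beta> > 0" and "b > 0" and "\<sigma> > 0"
    and "cont_diff_on {0..\<sigma>} f"
    and "cont_diff_on {0..b} u0"
    and "u0 0 = f 0"
    and "u0 b = \<beta>"
    and "\<And>x. 0 \<le> x \<Longrightarrow> x < b \<Longrightarrow> u0 x > \<beta>"
    and "\<And>t. 0 \<le> t \<Longrightarrow> t \<le> \<sigma> \<Longrightarrow> f t > 3 * \<beta> / 2"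
  shows "\<forall>y0 y1.
    (\<forall>V w. transformed D \<sigma> y0 y1 V w \<longrightarrow>
       (V_problem D \<beta> b \<sigma> C1 f u0 y0 y1 V \<longleftrightarrow> w_problem D \<beta> b \<sigma> C1 f u0 y0 y1 w)) \<and>
    (\<forall>V. V_problem D \<beta> b \<sigma> C1 f u0 y0 y1 V \<longrightarrow> (\<exists>w. transformed D \<sigma> y0 y1 V w)) \<and>
    (\<forall>w. w_problem D \<beta> b \<sigma> C1 f u0 y0 y1 w \<longrightarrow> (\<exists>V. transformed D \<sigma> y0 y1 V w)) \<and>
    (\<forall>w. w_problem D \<beta> b \<sigma> C1 f u0 y0 y1 w \<longrightarrow>
       (\<forall>y\<in>{C1..C2 u0 b C1}.
          F D \<beta> u0 b C1 y =
            V0 \<beta> u0 b C1 y * (1 + 1 / D * integral {y..C2 u0 b C1} (\<lambda>\<xi>. w \<xi> 0))))"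
proof (intro allI conjI impI ballI)
  note D = \<open>D > 0\<close>
  have contf: "continuous_on {0..\<sigma>} f"
    using assms(5) unfolding cont_diff_on_def
    by (meson DERIV_continuous continuous_on_eq_continuous_within)
  have f: "f t > \<beta>" if "t \<in> {0..\<sigma>}" for t
    using assms(10)[of t] \<open>\<beta> > 0\<close> that by simp
  note V0 = initial_profile[where ?C1.0 = C1, OF assms(3,2,6,8,9)]
  have iff: "V_problem D \<beta> b \<sigma> C1 f u0 y0 y1 V \<longleftrightarrow> w_problem D \<beta> b \<sigma> C1 f u0 y0 y1 w"
    if "hopf_cole_pair D \<sigma> y0 y1 V w Z" for y0 y1 V w Z
    by (rule hopf_cole_pair.problem_iff[OF that assms(1,2,4) contf f V0(1)])
  fix y0 y1
  show "V_problem D \<beta> b \<sigma> C1 f u0 y0 y1 V \<longleftrightarrow> w_problem D \<beta> b \<sigma> C1 f u0 y0 y1 w"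
    if "transformed D \<sigma> y0 y1 V w" for V w
    using iff hopf_cole_pair_of_transformed_V[OF D _ that] hopf_cole_pair_of_transformed_w[OF D _ that]
    by metis
  show "\<exists>w. transformed D \<sigma> y0 y1 V w" if "V_problem D \<beta> b \<sigma> C1 f u0 y0 y1 V" for V
    using hopf_cole_pair.transformed_pair[OF hopf_cole_pair_from_V[OF D V_problemD[OF that] refl]]
    by blast
  fix w assume w: "w_problem D \<beta> b \<sigma> C1 f u0 y0 y1 w"
  note W = w_problemD[OF w]
  show "\<exists>V. transformed D \<sigma> y0 y1 V w"
    using hopf_cole_pair.transformed_pair[OF hopf_cole_pair_from_w[OF D W(1,2,3,8,9) refl
          w_problem_denominator_pos[OF D w assms(4) f V0(2,3)] refl]]
    by blast
  fix y assume y: "y \<in> {C1..C2 u0 b C1}"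
  have "integral {y..C2 u0 b C1} (\<lambda>\<xi>. w \<xi> 0) = integral {y..C2 u0 b C1} (F D \<beta> u0 b C1)"
    by (rule integral_cong) (use W(5) y in auto)
  then show "F D \<beta> u0 b C1 y =
      V0 \<beta> u0 b C1 y * (1 + 1 / D * integral {y..C2 u0 b C1} (\<lambda>\<xi>. w \<xi> 0))"
    using exp_tail_eq_affine_tail[OF D V0(1) y] by (simp add: F_def)
qed

end
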